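(* Let $G$ be a discrete group. Every minimal tame amenable $G$-flow is uniquely ergodic; that is, it carries exactly one $G$-invariant regular Borel probability measure.
   Context: All compact spaces are Hausdorff (no metrizability is assumed). A $G$-flow $(X,G)$ is a compact space $X$ with an action of the discrete group $G$ by homeomorphisms; it is minimal if every orbit is dense, and amenable if it carries a $G$-invariant regular Borel probability measure. The enveloping semigroup $E(X,G)$ is the closure of $\{g_X:g\in G\}$ in $X^X$ with the product topology, where $g_X(x)=gx$. A map $f:X\to Y$ from a compact space to a uniform space is fragmented if for every nonempty $A\subseteq X$ and every entourage $V$ of $Y$ there is a nonempty relatively open $U\subseteq A$ with $(f(x),f(y))\in V$ for all $x,y\in U$. The flow $(X,G)$ is tame if every element of $E(X,G)$ is a fragmented map $X\to X$ (with $X$ carrying its unique compatible uniformity). *)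

theory Defs
  imports "HOL-Probability.Probability" "HOL-Algebra.Group_Action"
begin

locale flow = group_action G UNIV \<phi>
  for G (structure) and \<phi> :: "'g \<Rightarrow> 'x::t2_space \<Rightarrow> 'x" +
  assumes compact_space: "compact (UNIV :: 'x set)"
    and homeo: "g \<in> carrier G \<Longrightarrow> \<exists>h. homeomorphism UNIV UNIV (\<phi> g) h"

definition minimal_flow ::
  "('g, 'm) monoid_scheme \<Rightarrow> ('g \<Rightarrow> 'x::topological_space \<Rightarrow> 'x) \<Rightarrow> bool" where
  "minimal_flow G \<phi> \<longleftrightarrow> (\<forall>x. closure (orbit G \<phi> x) = UNIV)"

definition regular_borel_prob :: "'x::topological_space measure \<Rightarrow> bool" where
  "regular_borel_prob \<mu> \<longleftrightarrow>
     prob_space \<mu> \<and> sets \<mu> = sets borel \<and>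
     (\<forall>B \<in> sets borel. emeasure \<mu> B = (SUP K \<in> {K. K \<subseteq> B \<and> compact K}. emeasure \<mu> K)) \<and>
     (\<forall>B \<in> sets borel. emeasure \<mu> B = (INF U \<in> {U. B \<subseteq> U \<and> open U}. emeasure \<mu> U))"

definition invariant_measure ::
  "('g, 'm) monoid_scheme \<Rightarrow> ('g \<Rightarrow> 'x::topological_space \<Rightarrow> 'x) \<Rightarrow> 'x measure \<Rightarrow> bool" where
  "invariant_measure G \<phi> \<mu> \<longleftrightarrow> (\<forall>g \<in> carrier G. distr \<mu> borel (\<phi> g) = \<mu>)"

definition amenable_flow ::
  "('g, 'm) monoid_scheme \<Rightarrow> ('g \<Rightarrow> 'x::topological_space \<Rightarrow> 'x) \<Rightarrow> bool" where
  "amenable_flow G \<phi> \<longleftrightarrow> (\<exists>\<mu>. regular_borel_prob \<mu> \<and> invariant_measure G \<phi> \<mu>)"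

definition uniquely_ergodic ::
  "('g, 'm) monoid_scheme \<Rightarrow> ('g \<Rightarrow> 'x::topological_space \<Rightarrow> 'x) \<Rightarrow> bool" where
  "uniquely_ergodic G \<phi> \<longleftrightarrow> (\<exists>!\<mu>. regular_borel_prob \<mu> \<and> invariant_measure G \<phi> \<mu>)"

text \<open>The topology on \<^typ>\<open>'x \<Rightarrow> 'x\<close> is the product topology
  (theory \<open>HOL-Analysis.Function_Topology\<close>), i.e. pointwise convergence.\<close>

definition enveloping_semigroup ::
  "('g, 'm) monoid_scheme \<Rightarrow> ('g \<Rightarrow> 'x::topological_space \<Rightarrow> 'x) \<Rightarrow> ('x \<Rightarrow> 'x) set" where
  "enveloping_semigroup G \<phi> = closure (\<phi> ` carrier G)"

definition fragmented :: "('x::topological_space \<Rightarrow> 'y::uniform_space) \<Rightarrow> bool" where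
  "fragmented f \<longleftrightarrow>
     (\<forall>A V. A \<noteq> {} \<longrightarrow> (\<forall>\<^sub>F p in uniformity. p \<in> V) \<longrightarrow>
        (\<exists>U. openin (top_of_set A) U \<and> U \<noteq> {} \<and> (\<forall>x \<in> U. \<forall>y \<in> U. (f x, f y) \<in> V)))"

text \<open>The class \<^class>\<open>uniform_space\<close> requires the uniformity to induce the given topology.
  A compact Hausdorff space has exactly one such uniformity, so for flows the class constraint
  neither restricts the space nor adds data to it.\<close>

definition tame_flow ::
  "('g, 'm) monoid_scheme \<Rightarrow> ('g \<Rightarrow> 'x::uniform_space \<Rightarrow> 'x) \<Rightarrow> bool" where
  "tame_flow G \<phi> \<longleftrightarrow> (\<forall>p \<in> enveloping_semigroup G \<phi>. fragmented p)"

end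

theory Submission
  imports Defs
begin

text \<open>
  Let \<open>\<mu>\<close> and \<open>\<nu>\<close> be invariant and suppose that a continuous \<open>f\<close> with values in \<open>[0,1]\<close> has a smaller
  integral for \<open>\<mu>\<close> than for \<open>\<nu>\<close>. Consider the averages of the translates \<open>f \<circ> \<phi> g\<close>. Averaging does not
  change either integral, and by the mean ergodic argument there are averages \<open>\<psi> n\<close> that become almost
  invariant in \<open>L\<^sup>2\<close> of both measures (\<open>almost_invariant_averages\<close>). Pick \<open>a < b\<close> strictly between the two
  integrals. By minimality, almost invariance spreads the values: on every nonempty open set, \<open>\<psi> n\<close>
  eventually takes values below \<open>a\<close>, because its \<open>\<mu>\<close>-mean is smaller than \<open>a\<close>, and values above \<open>b\<close>, because
  its \<open>\<nu>\<close>-mean is larger than \<open>b\<close> (\<open>almost_invariant_small_everywhere\<close>). So a subsequence of the \<open>\<psi> n\<close>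
  is independent: each prescription of "below \<open>a\<close>" or "above \<open>b\<close>" for finitely many members is
  realised at some point.

  Independence of averages implies independence of a sequence of the averaged functions themselves
  (\<open>independent_seq_midpoint_hull\<close>). This is the heart of the matter. Each sequence of coin flips
  prescribes values of the averages, and a measurable choice of points realising the prescriptions
  (\<open>measurable_section\<close>) turns all functions involved into random variables on the coin-flip space. There
  the averages correlate with the Rademacher functions, so suitable translates \<open>f \<circ> \<phi> (s i)\<close> do too, and
  by Bessel's inequality these cannot cluster in \<open>L\<^sup>1\<close>. A bounded sequence without clustering splits
  every subset of some set of positive probability (\<open>independent_or_close\<close>) and so has an independent
  subsequence (\<open>independent_subsequence\<close>).

  Finally, if the translates \<open>f \<circ> \<phi> (s i)\<close> are independent, no cluster point of the \<open>\<phi> (s i)\<close> in the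
  product space is fragmented (\<open>independent_cluster_point_not_fragmented\<close>), yet such a cluster point lies
  in the enveloping semigroup of a tame flow. Hence all invariant measures give the same integrals
  to continuous functions, and by regularity they coincide (\<open>regular_borel_prob_eqI\<close>).
\<close>

section \<open>Independent sequences of functions\<close>

definition independent_seq :: "(nat \<Rightarrow> 'a \<Rightarrow> real) \<Rightarrow> real \<Rightarrow> real \<Rightarrow> bool" where
  "independent_seq h a b \<longleftrightarrow> (\<forall>\<sigma> n. \<exists>x. \<forall>i<n. if \<sigma> i then b < h i x else h i x < a)"

text \<open>
  The filter \<open>F\<close> lets finitely many big sets be split by the same index, so the \<open>2 ^ n\<close> cells already
  obtained can all be split at once, and the indices can be chosen one after the other. Big means
  "of positive measure" in one use of this lemma and "nonempty and open" in the other.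
\<close>

lemma independent_subsequence:
  fixes A B :: "nat \<Rightarrow> 'a set" and big :: "'a set \<Rightarrow> bool"
  assumes F: "F \<noteq> bot" "F \<le> sequentially" and K: "big K"
    and split: "\<And>D. big D \<Longrightarrow> D \<subseteq> K \<Longrightarrow> \<forall>\<^sub>F i in F. big (D \<inter> A i) \<and> big (D \<inter> B i)"
  shows "\<exists>r :: nat \<Rightarrow> nat. \<forall>\<sigma> n. big (K \<inter> {x. \<forall>i<n. if \<sigma> i then x \<in> B (r i) else x \<in> A (r i)})"
proof -
  (* A state is the last chosen index together with the family of all cells cut out so far. *)
  define P where "P n s = (finite (snd s) \<and> (\<forall>D\<in>snd s. big D \<and> D \<subseteq> K) \<and> (n = 0 \<longrightarrow> snd s = {K}))"
    for n :: nat and s :: "nat \<times> 'a set set"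
  define Q where "Q s t = (snd t = (\<lambda>D. D \<inter> A (fst t)) ` snd s \<union> (\<lambda>D. D \<inter> B (fst t)) ` snd s)"
    for s t :: "nat \<times> 'a set set"
  have "\<exists>s. \<forall>n. P n (s n) \<and> Q (s n) (s (Suc n))"
  proof (rule dependent_nat_choice)
    show "\<exists>s. P 0 s" using K by (auto simp: P_def intro!: exI[of _ 0])
  next
    fix s n assume P: "P n s"
    then have "\<forall>\<^sub>F i in F. \<forall>D\<in>snd s. big (D \<inter> A i) \<and> big (D \<inter> B i)"
      by (intro eventually_ball_finite) (auto simp: P_def intro: split)
    then obtain i where "\<forall>D\<in>snd s. big (D \<inter> A i) \<and> big (D \<inter> B i)"
      using F(1) eventually_happens by blast
    then show "\<exists>t. P (Suc n) t \<and> Q s t"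
      using P by (auto simp: P_def Q_def intro!: exI[of _ i])
  qed
  then obtain s where s: "\<And>n. P n (s n)" "\<And>n. Q (s n) (s (Suc n))" by blast
  have "K \<inter> {x. \<forall>i<n. if \<sigma> i then x \<in> B (fst (s (Suc i))) else x \<in> A (fst (s (Suc i)))} \<in> snd (s n)"
    (is "?cell n \<in> _") for \<sigma> n
  proof (induction n)
    case 0 then show ?case using s(1)[of 0] by (simp add: P_def)
  next
    case (Suc n)
    have "?cell (Suc n) = ?cell n \<inter> (if \<sigma> n then B (fst (s (Suc n))) else A (fst (s (Suc n))))"
      by (auto simp: less_Suc_eq)
    then show ?case using Suc s(2)[of n] by (auto simp: Q_def)
  qed
  then have "big (K \<inter> {x. \<forall>i<n. if \<sigma> i then x \<in> B (fst (s (Suc i))) else x \<in> A (fst (s (Suc i)))})" for \<sigma> n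
    using s(1)[of n] unfolding P_def by blast
  then show ?thesis by (intro exI[of _ "\<lambda>i. fst (s (Suc i))"]) blast
qed

section \<open>Compactness\<close>

lemma decseq_closed_Inter_nonempty:
  fixes C :: "nat \<Rightarrow> 'a::topological_space set"
  assumes "compact (UNIV :: 'a set)" "\<And>n. closed (C n)" "\<And>n. C n \<noteq> {}" "decseq C"
  shows "(\<Inter>n. C n) \<noteq> {}"
proof -
  have "UNIV \<inter> (\<Inter>n\<in>UNIV. C n) \<noteq> {}"
  proof (rule compact_imp_fip_image[OF assms(1)])
    fix I :: "nat set" assume I: "finite I" "I \<subseteq> UNIV"
    then obtain m where m: "\<forall>i\<in>I. i \<le> m" using finite_nat_set_iff_bounded_le by auto
    have "C m \<subseteq> (\<Inter>i\<in>I. C i)"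
      using m assms(4) by (auto simp: decseq_def)
    then show "UNIV \<inter> (\<Inter>i\<in>I. C i) \<noteq> {}" using assms(3)[of m] by auto
  qed (use assms in auto)
  then show ?thesis by simp
qed

lemma closed_sets_meet:
  fixes Q :: "nat \<Rightarrow> 'a::topological_space set"
  assumes "compact (UNIV :: 'a set)" "\<And>i. closed (Q i)" "closed K"
    and fin: "\<And>n. \<exists>x\<in>K. \<forall>i<n. x \<in> Q i"
  shows "\<exists>x\<in>K. \<forall>i. x \<in> Q i"
proof -
  have "(\<Inter>n. K \<inter> (\<Inter>i\<in>{..<n}. Q i)) \<noteq> {}"
  proof (rule decseq_closed_Inter_nonempty[OF assms(1)])
    show "closed (K \<inter> (\<Inter>i\<in>{..<n}. Q i))" for n using assms by auto
    show "K \<inter> (\<Inter>i\<in>{..<n}. Q i) \<noteq> {}" for n using fin[of n] by blast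
    show "decseq (\<lambda>n. K \<inter> (\<Inter>i\<in>{..<n}. Q i))"
      unfolding decseq_def by (intro allI impI Int_mono INT_anti_mono) auto
  qed
  then show ?thesis by blast
qed

lemma compact_UNIV_fun:
  assumes "compact (UNIV :: 'b::topological_space set)"
  shows "compact (UNIV :: ('a \<Rightarrow> 'b) set)"
proof -
  have "compact_space (euclidean :: 'b topology)"
    using assms by (simp add: compact_space_def)
  then have "compact_space (product_topology (\<lambda>i::'a. euclidean :: 'b topology) UNIV)"
    unfolding compact_space_product_topology by blast
  then have "compactin (euclidean :: ('a \<Rightarrow> 'b) topology) UNIV"
    unfolding euclidean_product_topology compact_space_def by simp
  then show ?thesis by simp
qed

lemma cluster_point_exists:
  fixes s :: "nat \<Rightarrow> 'a::topological_space"
  assumes "compact (UNIV :: 'a set)"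
  obtains p where "\<And>n. p \<in> closure (s ` {n..})"
proof -
  have "(\<Inter>n. closure (s ` {n..})) \<noteq> {}"
  proof (rule decseq_closed_Inter_nonempty[OF assms])
    show "decseq (\<lambda>n. closure (s ` {n..}))"
      unfolding decseq_def by (intro allI impI closure_mono image_mono) simp
  qed auto
  then show ?thesis using that by auto
qed

text \<open>
  An ultrafilter on \<open>nat\<close> is a \<open>{0,1}\<close>-valued function on the sets of naturals, subject to clopen
  conditions that the principal ultrafilters satisfy. A cluster point of the sequence of principal
  ultrafilters therefore satisfies them as well, and it contains every cofinite set.
\<close>

lemma free_ultrafilter_exists:
  obtains F :: "nat filter" where "F \<noteq> bot" "F \<le> sequentially"
    "\<And>P. eventually P F \<or> eventually (\<lambda>i. \<not> P i) F"
proof -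
  define s where "s n = (\<lambda>S :: nat set. n \<in> S)" for n
  have "compact (UNIV :: bool set)" by (simp add: finite_imp_compact)
  then obtain p where p: "\<And>n. p \<in> closure (s ` {n..})"
    using cluster_point_exists[OF compact_UNIV_fun] by blast
  have cont: "continuous_on UNIV (\<lambda>f :: nat set \<Rightarrow> bool. f S)" for S
    by simp
  have clopen: "open {f :: nat set \<Rightarrow> bool. Q (f S) (f T) (f R)}" for Q S T R
  proof -
    have 1: "open {f :: nat set \<Rightarrow> bool. f S = b}" for b S
      using open_vimage[OF discrete_topology_class.open_discrete[of "{b}"] cont[of S]] by (simp add: vimage_def)
    have "{f :: nat set \<Rightarrow> bool. Q (f S) (f T) (f R)}
      = (\<Union>(a,b,c)\<in>{(a,b,c). Q a b c}. {f. f S = a} \<inter> {f. f T = b} \<inter> {f. f R = c})"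
      by auto
    moreover have "open (\<Union>(a,b,c)\<in>{(a,b,c). Q a b c}. {f. f S = a} \<inter> {f. f T = b} \<inter> {f :: nat set \<Rightarrow> bool. f R = c})"
      by (rule open_UN) (simp add: split_beta 1 open_Int)
    ultimately show ?thesis by simp
  qed
  have test: "Q (p S) (p T) (p R)" if "\<And>i. i \<ge> n \<Longrightarrow> Q (i \<in> S) (i \<in> T) (i \<in> R)" for Q S T R n
  proof -
    have "closed {f :: nat set \<Rightarrow> bool. Q (f S) (f T) (f R)}"
      using clopen[of "\<lambda>a b c. \<not> Q a b c" S T R] by (simp add: closed_def Collect_neg_eq)
    moreover have "s ` {n..} \<subseteq> {f. Q (f S) (f T) (f R)}"
      using that by (auto simp: s_def)
    ultimately show ?thesis using p[of n] closure_minimal by blast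
  qed
  define F where "F = Abs_filter (\<lambda>P. p {n. P n})"
  have ev: "eventually P F \<longleftrightarrow> p {n. P n}" for P
    unfolding F_def
  proof (rule eventually_Abs_filter, rule is_filter.intro)
    show "p {n. True}" using test[of 0 "\<lambda>a b c. a" "{n. True}"] by auto
  next
    fix P Q assume "p {n. P n}" "p {n. Q n}"
    then show "p {n. P n \<and> Q n}"
      using test[of 0 "\<lambda>a b c. a \<and> b \<longrightarrow> c" "{n. P n}" "{n. Q n}" "{n. P n \<and> Q n}"] by auto
  next
    fix P Q assume "\<forall>x. P x \<longrightarrow> Q x" "p {n. P n}"
    then show "p {n. Q n}"
      using test[of 0 "\<lambda>a b c. a \<longrightarrow> b" "{n. P n}" "{n. Q n}"] by auto
  qed
  show ?thesis
  proof
    show "F \<noteq> bot"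
      using test[of 0 "\<lambda>a b c. \<not> a" "{}"] by (auto simp: trivial_limit_def ev)
    show "F \<le> sequentially"
    proof (rule filter_leI)
      fix P assume "eventually P sequentially"
      then obtain N where "\<And>n. n \<ge> N \<Longrightarrow> P n" by (auto simp: eventually_sequentially)
      then show "eventually P F"
        using test[of N "\<lambda>a b c. a" "{n. P n}"] by (auto simp: ev)
    qed
    show "eventually P F \<or> eventually (\<lambda>i. \<not> P i) F" for P
      using test[of 0 "\<lambda>a b c. a \<or> b" "{n. P n}" "{n. \<not> P n}"] by (auto simp: ev)
  qed
qed

section \<open>A measurable section\<close>

text \<open>
  The sets \<open>P i (\<sigma> i)\<close> cut out a compact fibre over each \<open>\<sigma>\<close>, and \<open>z \<sigma>\<close> is chosen in it greedily:
  intersect the fibre with \<open>C 0\<close>, \<open>C 1\<close>, and so on in turn whenever the intersection stays nonempty. Then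
  \<open>z \<sigma> \<in> C j\<close> says just that the \<open>j\<close>-th intersection was nonempty. By compactness, whether a fibre
  meets a given closed set is decided by countably many conditions on finitely many coordinates.
  This gives measurability with respect to countably many closed sets without any metrizability.
\<close>

lemma measurable_section:
  fixes M :: "(nat \<Rightarrow> bool) measure" and P :: "nat \<Rightarrow> bool \<Rightarrow> 'x::topological_space set"
    and C :: "nat \<Rightarrow> 'x set"
  assumes cpt: "compact (UNIV :: 'x set)"
    and P: "\<And>i b. closed (P i b)" and C: "\<And>j. closed (C j)"
    and M: "space M = UNIV" "\<And>i. {\<sigma>. \<sigma> i} \<in> sets M"
    and ne: "\<And>\<sigma> n. \<exists>x. \<forall>i<n. x \<in> P i (\<sigma> i)"
  obtains z where "\<And>\<sigma> i. z \<sigma> \<in> P i (\<sigma> i)" "\<And>j. {\<sigma>. z \<sigma> \<in> C j} \<in> sets M"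
proof -
  have neg: "- S \<in> sets M" if "S \<in> sets M" for S
    using sets.compl_sets[OF that] M(1) by (simp add: Compl_eq_Diff_UNIV)
  define fib where "fib \<sigma> = (\<Inter>i. P i (\<sigma> i))" for \<sigma>
  have cfib: "closed (fib \<sigma>)" for \<sigma> unfolding fib_def using P by auto
  have meas_n: "{\<sigma>. \<exists>x\<in>K. \<forall>i<n. x \<in> P i (\<sigma> i)} \<in> sets M" for n K
  proof (induction n arbitrary: K)
    case 0
    have "{\<sigma> :: nat \<Rightarrow> bool. \<exists>x. x \<in> K} = (if K = {} then {} else space M)" using M(1) by auto
    then show ?case by simp
  next
    case (Suc n)
    have "{\<sigma>. \<exists>x\<in>K. \<forall>i<Suc n. x \<in> P i (\<sigma> i)}
      = ({\<sigma>. \<sigma> n} \<inter> {\<sigma>. \<exists>x\<in>K \<inter> P n True. \<forall>i<n. x \<in> P i (\<sigma> i)})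
      \<union> (- {\<sigma>. \<sigma> n} \<inter> {\<sigma>. \<exists>x\<in>K \<inter> P n False. \<forall>i<n. x \<in> P i (\<sigma> i)})" (is "?L = ?R")
    proof (intro Set.set_eqI)
      show "\<sigma> \<in> ?L \<longleftrightarrow> \<sigma> \<in> ?R" for \<sigma>
        by (cases "\<sigma> n") (auto simp: less_Suc_eq)
    qed
    then show ?case using Suc[of "K \<inter> P n True"] Suc[of "K \<inter> P n False"] M(2)[of n] neg[OF M(2)[of n]]
      by auto
  qed
  have fib_iff: "fib \<sigma> \<inter> K \<noteq> {} \<longleftrightarrow> (\<forall>n. \<exists>x\<in>K. \<forall>i<n. x \<in> P i (\<sigma> i))" if K: "closed K" for \<sigma> K
    using closed_sets_meet[OF cpt, of "\<lambda>i. P i (\<sigma> i)" K] P that unfolding fib_def by blast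
  have fib_ne: "fib \<sigma> \<noteq> {}" for \<sigma>
    using fib_iff[of UNIV \<sigma>] ne by auto
  have meas_fib: "{\<sigma>. fib \<sigma> \<inter> K \<noteq> {}} \<in> sets M" if "closed K" for K
  proof -
    have "{\<sigma>. fib \<sigma> \<inter> K \<noteq> {}} = (\<Inter>n. {\<sigma>. \<exists>x\<in>K. \<forall>i<n. x \<in> P i (\<sigma> i)})"
      using fib_iff[OF that] by auto
    then show ?thesis using meas_n by auto
  qed
  define W where "W \<sigma> = rec_nat (fib \<sigma>) (\<lambda>j W. if W \<inter> C j \<noteq> {} then W \<inter> C j else W)" for \<sigma>
  have W0: "W \<sigma> 0 = fib \<sigma>" and
    WS: "W \<sigma> (Suc j) = (if W \<sigma> j \<inter> C j \<noteq> {} then W \<sigma> j \<inter> C j else W \<sigma> j)" for \<sigma> j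
    by (auto simp: W_def)
  have W: "closed (W \<sigma> j) \<and> W \<sigma> j \<noteq> {}" for \<sigma> j
    by (induction j) (use C cfib fib_ne in \<open>auto simp: W0 WS\<close>)
  have "decseq (W \<sigma>)" for \<sigma> by (rule decseq_SucI) (auto simp: WS)
  then have "(\<Inter>j. W \<sigma> j) \<noteq> {}" for \<sigma> using W by (intro decseq_closed_Inter_nonempty[OF cpt]) auto
  then have "\<exists>z. \<forall>\<sigma>. z \<sigma> \<in> (\<Inter>j. W \<sigma> j)"
    by (intro choice allI) blast
  then obtain z where z: "\<And>\<sigma>. z \<sigma> \<in> (\<Inter>j. W \<sigma> j)" by blast
  have meas_W: "{\<sigma>. W \<sigma> j \<inter> K \<noteq> {}} \<in> sets M" if "closed K" for j K
    using that
  proof (induction j arbitrary: K)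
    case 0 then show ?case using meas_fib by (simp add: W0)
  next
    case (Suc j)
    have "{\<sigma>. W \<sigma> (Suc j) \<inter> K \<noteq> {}} = ({\<sigma>. W \<sigma> j \<inter> C j \<noteq> {}} \<inter> {\<sigma>. W \<sigma> j \<inter> (C j \<inter> K) \<noteq> {}})
      \<union> (- {\<sigma>. W \<sigma> j \<inter> C j \<noteq> {}} \<inter> {\<sigma>. W \<sigma> j \<inter> K \<noteq> {}})"
      by (auto simp: WS)
    then show ?case
      using Suc.IH[of "C j"] Suc.IH[of "C j \<inter> K"] Suc.IH[of K] Suc.prems C[of j]
        neg[OF Suc.IH[of "C j"]] by auto
  qed
  have "z \<sigma> \<in> C j \<longleftrightarrow> W \<sigma> j \<inter> C j \<noteq> {}" for \<sigma> j
  proof -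
    have "z \<sigma> \<in> W \<sigma> j" "z \<sigma> \<in> W \<sigma> (Suc j)" using z[of \<sigma>] by auto
    then show ?thesis by (auto simp: WS split: if_splits)
  qed
  then have "{\<sigma>. z \<sigma> \<in> C j} \<in> sets M" for j using meas_W[OF C] by auto
  moreover have "z \<sigma> \<in> P i (\<sigma> i)" for \<sigma> i using z[of \<sigma>] W0[of \<sigma>] by (auto simp: fib_def)
  ultimately show ?thesis using that by blast
qed

section \<open>Midpoint hulls\<close>

text \<open>
  Averages by repeated halving suffice below and are easier to induct on than convex combinations.
\<close>

inductive_set midpoint_hull :: "('a \<Rightarrow> real) set \<Rightarrow> ('a \<Rightarrow> real) set" for S where
  base: "h \<in> S \<Longrightarrow> h \<in> midpoint_hull S"
| midpoint: "\<psi> \<in> midpoint_hull S \<Longrightarrow> \<xi> \<in> midpoint_hull S \<Longrightarrow>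
    (\<lambda>x. (\<psi> x + \<xi> x) / 2) \<in> midpoint_hull S"

lemma midpoint_hull_mono:
  assumes "\<psi> \<in> midpoint_hull S" "S \<subseteq> T"
  shows "\<psi> \<in> midpoint_hull T"
  using assms by (induction) (auto intro: midpoint_hull.intros)

lemma midpoint_hull_countable:
  assumes "\<psi> \<in> midpoint_hull S"
  obtains T where "T \<subseteq> S" "countable T" "\<psi> \<in> midpoint_hull T"
proof -
  have "\<exists>T\<subseteq>S. countable T \<and> \<psi> \<in> midpoint_hull T"
    using assms
  proof induction
    case (base h)
    then show ?case by (intro exI[of _ "{h}"]) (auto intro: midpoint_hull.base)
  next
    case (midpoint \<psi> \<xi>)
    then obtain T U where TU: "T \<subseteq> S" "countable T" "\<psi> \<in> midpoint_hull T"
      "U \<subseteq> S" "countable U" "\<xi> \<in> midpoint_hull U" by blast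
    then have "\<psi> \<in> midpoint_hull (T \<union> U)" "\<xi> \<in> midpoint_hull (T \<union> U)"
      by (auto intro: midpoint_hull_mono)
    then show ?case using TU
      by (intro exI[of _ "T \<union> U"]) (auto intro: midpoint_hull.midpoint)
  qed
  then show ?thesis using that by blast
qed

lemma midpoint_hull_ge:
  assumes "\<psi> \<in> midpoint_hull S" "\<delta> \<le> L \<psi>"
    and "\<And>\<psi> \<xi>. \<psi> \<in> midpoint_hull S \<Longrightarrow> \<xi> \<in> midpoint_hull S \<Longrightarrow>
      L (\<lambda>x. (\<psi> x + \<xi> x) / 2) = (L \<psi> + L \<xi>) / (2::real)"
  shows "\<exists>h\<in>S. \<delta> \<le> L h"
  using assms(1,2)
proof induction
  case (midpoint \<psi> \<xi>)
  then have "\<delta> \<le> (L \<psi> + L \<xi>) / 2" using assms(3) by metis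
  then have "\<delta> \<le> L \<psi> \<or> \<delta> \<le> L \<xi>" by (auto simp: field_simps)
  then show ?case using midpoint.IH by blast
qed blast

lemma midpoint_hull_unit_interval:
  assumes "\<psi> \<in> midpoint_hull S" "\<And>h x. h \<in> S \<Longrightarrow> 0 \<le> h x \<and> h x \<le> 1"
  shows "0 \<le> \<psi> x \<and> \<psi> x \<le> 1"
  using assms(1) by induction (auto dest: assms(2))

lemma midpoint_hull_continuous:
  assumes "\<psi> \<in> midpoint_hull S" "\<And>h. h \<in> S \<Longrightarrow> continuous_on UNIV h"
  shows "continuous_on UNIV \<psi>"
  using assms(1) by induction (auto intro!: continuous_intros dest: assms(2))

section \<open>Coin flips and Rademacher functions\<close>

text \<open>
  Bessel's inequality: \<open>k\<close> has norm at most 1 and correlates with each \<open>r j\<close>, so \<open>k - \<delta> * (\<Sum>j\<in>J. r j)\<close>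
  would have negative norm if \<open>J\<close> were too large.
\<close>

lemma (in prob_space) bessel_bound:
  fixes k :: "'a \<Rightarrow> real" and r :: "nat \<Rightarrow> 'a \<Rightarrow> real" and \<delta> :: real
  assumes k[measurable]: "k \<in> borel_measurable M" and kb: "\<And>x. 0 \<le> k x \<and> k x \<le> 1"
    and r[measurable]: "\<And>i. r i \<in> borel_measurable M" and rb: "\<And>i x. \<bar>r i x\<bar> \<le> 1"
    and orth: "\<And>i j. expectation (\<lambda>x. r i x * r j x) = (if i = j then 1 else 0)"
    and J: "finite J" and \<delta>: "\<delta> > 0" and corr: "\<And>j. j \<in> J \<Longrightarrow> expectation (\<lambda>x. k x * r j x) \<ge> \<delta>"
  shows "card J * \<delta>\<^sup>2 \<le> 1"
proof -
  define R where "R x = (\<Sum>j\<in>J. r j x)" for x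
  have rr: "integrable M (\<lambda>x. r i x * r j x)" for i j
    by (rule integrable_const_bound[where B = 1])
       (use mult_mono[OF rb rb] in \<open>auto simp: abs_mult\<close>)
  have kr: "integrable M (\<lambda>x. k x * r j x)" for j
  proof (rule integrable_const_bound[where B = 1])
    show "AE x in M. norm (k x * r j x) \<le> 1"
      using mult_mono[of "k x" 1 "\<bar>r j x\<bar>" 1 for x] kb rb by (auto simp: abs_mult)
  qed simp
  have kk: "integrable M (\<lambda>x. k x * k x)"
  proof (rule integrable_const_bound[where B = 1])
    show "AE x in M. norm (k x * k x) \<le> 1"
      using mult_mono[of "k x" 1 "k x" 1 for x] kb by (auto simp: abs_mult)
  qed simp
  have RR: "R x * R x = (\<Sum>i\<in>J. \<Sum>j\<in>J. r i x * r j x)" for x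
    by (simp add: R_def sum_product)
  have iR: "integrable M (\<lambda>x. R x * R x)" unfolding RR using rr by auto
  have kR: "k x * R x = (\<Sum>j\<in>J. k x * r j x)" for x by (simp add: R_def sum_distrib_left)
  have ikR: "integrable M (\<lambda>x. k x * R x)" unfolding kR using kr by auto
  have ER: "expectation (\<lambda>x. R x * R x) = card J"
    unfolding RR using rr J by (simp add: orth)
  have "card J * \<delta> = (\<Sum>j\<in>J. \<delta>)" by simp
  also have "\<dots> \<le> (\<Sum>j\<in>J. expectation (\<lambda>x. k x * r j x))" using corr by (intro sum_mono) auto
  also have "\<dots> = expectation (\<lambda>x. k x * R x)" unfolding kR using kr by simp
  finally have EkR: "card J * \<delta> \<le> expectation (\<lambda>x. k x * R x)" .
  have Ekk: "expectation (\<lambda>x. k x * k x) \<le> 1"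
    using integral_mono[of M "\<lambda>x. k x * k x" "\<lambda>x. 1"] kk kb mult_mono[of "k x" 1 "k x" 1 for x]
    by (simp add: prob_space)
  have "0 \<le> expectation (\<lambda>x. (k x - \<delta> * R x)\<^sup>2)" by simp
  also have "(\<lambda>x. (k x - \<delta> * R x)\<^sup>2) = (\<lambda>x. k x * k x - 2 * \<delta> * (k x * R x) + \<delta>\<^sup>2 * (R x * R x))"
    by (auto simp: power2_eq_square algebra_simps)
  also have "expectation \<dots> = expectation (\<lambda>x. k x * k x) - 2 * \<delta> * expectation (\<lambda>x. k x * R x)
      + \<delta>\<^sup>2 * card J"
    using kk ikR iR by (simp add: ER)
  also have "\<dots> \<le> 1 - 2 * \<delta> * (card J * \<delta>) + \<delta>\<^sup>2 * card J"
    using Ekk mult_left_mono[OF EkR, of "2 * \<delta>"] \<delta> by linarith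
  finally show ?thesis by (simp add: power2_eq_square algebra_simps)
qed

definition coin_flips :: "(nat \<Rightarrow> bool) measure" where
  "coin_flips = (\<Pi>\<^sub>M i\<in>UNIV. measure_pmf (bernoulli_pmf (1/2)))"

definition rademacher :: "nat \<Rightarrow> (nat \<Rightarrow> bool) \<Rightarrow> real" where
  "rademacher i \<sigma> = (if \<sigma> i then 1 else -1)"

interpretation coin_flips: prob_space coin_flips
  unfolding coin_flips_def by (intro prob_space_PiM prob_space_measure_pmf)

lemma space_coin_flips: "space coin_flips = UNIV"
  by (simp add: coin_flips_def space_PiM)

lemma coin_flips_coordinate[measurable]: "(\<lambda>\<sigma>. \<sigma> i) \<in> measurable coin_flips (count_space UNIV)"
proof -
  have "(\<lambda>\<sigma>. \<sigma> i) \<in> measurable coin_flips (measure_pmf (bernoulli_pmf (1/2)))"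
    unfolding coin_flips_def by (rule measurable_component_singleton) simp
  then show ?thesis by simp
qed

lemma heads_sets: "{\<sigma>. \<sigma> i} \<in> sets coin_flips"
  using measurable_sets[OF coin_flips_coordinate, of "{True}" i]
  by (simp add: space_coin_flips vimage_def)

lemma rademacher_measurable[measurable]: "rademacher i \<in> borel_measurable coin_flips"
  unfolding rademacher_def by measurable

lemma coin_flips_heads:
  assumes "finite J"
  shows "coin_flips.prob {\<sigma>. \<forall>j\<in>J. \<sigma> j} = (1/2) ^ card J"
proof -
  interpret product_prob_space "\<lambda>_::nat. measure_pmf (bernoulli_pmf (1/2))" UNIV
    by unfold_locales
  have "emeasure coin_flips {\<sigma>\<in>space coin_flips. \<forall>j\<in>J. \<sigma> j \<in> {True}}
      = (\<Prod>j\<in>J. emeasure (measure_pmf (bernoulli_pmf (1/2))) {True})"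
    unfolding coin_flips_def by (rule emeasure_PiM_Collect) (use assms in auto)
  also have "\<dots> = ennreal ((1/2) ^ card J)"
    by (simp add: emeasure_pmf_single flip: ennreal_power)
  finally show ?thesis by (simp add: space_coin_flips measure_def)
qed

lemma rademacher_orthonormal:
  "coin_flips.expectation (\<lambda>\<sigma>. rademacher i \<sigma> * rademacher j \<sigma>) = (if i = j then 1 else 0)"
proof (cases "i = j")
  case True
  have "rademacher i \<sigma> * rademacher i \<sigma> = 1" for \<sigma> by (simp add: rademacher_def)
  then show ?thesis using True coin_flips.prob_space by simp
next
  case False
  define A where "A J = {\<sigma> :: nat \<Rightarrow> bool. \<forall>j\<in>J. \<sigma> j}" for J
  have sets: "A {i, j} \<in> sets coin_flips" "A {i} \<in> sets coin_flips" "A {j} \<in> sets coin_flips"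
    using heads_sets[of i] heads_sets[of j] sets.Int[OF heads_sets[of i] heads_sets[of j]]
    by (auto simp: A_def Collect_conj_eq)
  have int: "integrable coin_flips (indicat_real B)" if "B \<in> sets coin_flips" for B
    using that by (simp add: less_top[symmetric])
  have prob: "coin_flips.prob (A J) = (1/2) ^ card J" if "finite J" for J
    unfolding A_def using coin_flips_heads[OF that] .
  have eq: "(\<lambda>\<sigma>. rademacher i \<sigma> * rademacher j \<sigma>) = (\<lambda>\<sigma>. 4 * indicat_real (A {i, j}) \<sigma>
      - 2 * indicat_real (A {i}) \<sigma> - 2 * indicat_real (A {j}) \<sigma> + 1)"
    by (auto simp: rademacher_def indicator_def A_def)
  have "coin_flips.expectation (\<lambda>\<sigma>. rademacher i \<sigma> * rademacher j \<sigma>) = 4 * coin_flips.prob (A {i, j}) - 2 * coin_flips.prob (A {i})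
      - 2 * coin_flips.prob (A {j}) + 1"
    unfolding eq using int[OF sets(1)] int[OF sets(2)] int[OF sets(3)]
    by (simp add: coin_flips.prob_space[unfolded space_coin_flips] space_coin_flips)
  also have "\<dots> = 0"
    using False by (simp add: prob power2_eq_square)
  finally show ?thesis using False by simp
qed

section \<open>A dichotomy for bounded sequences of measurable functions\<close>

text \<open>
  If for no \<open>a < b\<close> there is a set all of whose subsets of positive measure keep being split between
  values below \<open>a\<close> and values above \<open>b\<close>, then inside every set of positive measure there is a smaller one on which, along the ultrafilter, the values avoid the lower or the upper third
  of their range almost surely; iterating, the values are forced into an arbitrarily short interval. Exhausting the space
  by such sets leaves a remainder of small measure. The point of recording closeness as an almost
  sure bound on a set, rather than as a small integral, is that it is stable under finite unions.
\<close>

lemma (in prob_space) independent_or_close: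
  fixes k :: "nat \<Rightarrow> 'a \<Rightarrow> real" and \<epsilon> :: real
  assumes k[measurable]: "\<And>i. k i \<in> borel_measurable M" and kb: "\<And>i x. 0 \<le> k i x \<and> k i x \<le> 1"
    and ultra: "\<And>P. eventually P F \<or> eventually (\<lambda>i. \<not> P i) F" and \<epsilon>: "\<epsilon> > 0"
  obtains (splitting) a b D where "a < b" "D \<in> sets M" "prob D > 0"
      "\<And>D'. D' \<in> sets M \<Longrightarrow> D' \<subseteq> D \<Longrightarrow> prob D' > 0 \<Longrightarrow>
        \<forall>\<^sub>F i in F. prob (D' \<inter> {x. k i x < a}) > 0 \<and> prob (D' \<inter> {x. b < k i x}) > 0"
  | (close) D where "D \<in> sets M" "prob D > 1 - \<epsilon>"
      "\<forall>\<^sub>F i in F. \<forall>\<^sub>F j in F. AE x in M. x \<in> D \<longrightarrow> \<bar>k i x - k j x\<bar> \<le> \<epsilon>"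
proof -
  define splits where "splits a b D' \<longleftrightarrow> (\<forall>\<^sub>F i in F. prob (D' \<inter> {x. k i x < a}) > 0 \<and> prob (D' \<inter> {x. b < k i x}) > 0)"
    for a b D'
  show ?thesis
  proof (cases "\<exists>a b D. a < b \<and> D \<in> sets M \<and> prob D > 0 \<and>
      (\<forall>D'. D' \<in> sets M \<longrightarrow> D' \<subseteq> D \<longrightarrow> prob D' > 0 \<longrightarrow> splits a b D')")
    case True
    then obtain a b D where *: "a < b" "D \<in> sets M" "prob D > 0"
      "\<And>D'. D' \<in> sets M \<Longrightarrow> D' \<subseteq> D \<Longrightarrow> prob D' > 0 \<Longrightarrow> splits a b D'" by blast
    show ?thesis by (rule splitting[OF *(1-3)]) (use *(4) in \<open>simp add: splits_def\<close>)
  next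
    case False
    have disj: "eventually P F \<or> eventually Q F" if "eventually (\<lambda>i. P i \<or> Q i) F" for P Q
      using ultra[of P]
    proof
      assume "eventually (\<lambda>i. \<not> P i) F"
      with that have "eventually Q F" by eventually_elim blast
      then show ?thesis ..
    qed simp
    have nsplit: "\<exists>D'. D' \<in> sets M \<and> D' \<subseteq> D \<and> prob D' > 0 \<and> \<not> splits a b D'"
      if "a < b" "D \<in> sets M" "prob D > 0" for a b D
    proof (rule ccontr)
      assume "\<not> ?thesis"
      then have "\<forall>D'. D' \<in> sets M \<longrightarrow> D' \<subseteq> D \<longrightarrow> prob D' > 0 \<longrightarrow> splits a b D'" by blast
      with that have "\<exists>a b D. a < b \<and> D \<in> sets M \<and> prob D > 0 \<and>
        (\<forall>D'. D' \<in> sets M \<longrightarrow> D' \<subseteq> D \<longrightarrow> prob D' > 0 \<longrightarrow> splits a b D')" by (intro exI conjI)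
      with False show False by (rule notE)
    qed
    have half: "\<exists>D'\<in>sets M. D' \<subseteq> D \<and> prob D' > 0 \<and>
        ((\<forall>\<^sub>F i in F. AE x in M. x \<in> D' \<longrightarrow> a \<le> k i x) \<or> (\<forall>\<^sub>F i in F. AE x in M. x \<in> D' \<longrightarrow> k i x \<le> b))"
      if ab: "a < b" and D: "D \<in> sets M" "prob D > 0" for a b D
    proof -
      obtain D' where D': "D' \<in> sets M" "D' \<subseteq> D" "prob D' > 0"
        and n: "\<not> splits a b D'"
        using nsplit[OF ab D] by (elim exE conjE)
      have D'_space: "D' \<inter> {x. P x} = {x\<in>space M. x \<in> D' \<and> P x}" for P
        using sets.sets_into_space[OF D'(1)] by auto
      note [measurable] = D'(1)
      have null: "AE x in M. x \<in> D' \<longrightarrow> \<not> P x" if "\<not> prob (D' \<inter> {x. P x}) > 0" "Measurable.pred M P" for P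
      proof -
        have [measurable]: "Measurable.pred M P" by fact
        have "prob {x\<in>space M. \<not> (x \<in> D' \<longrightarrow> \<not> P x)} = 0"
          using that(1) by (simp add: D'_space not_less measure_le_0_iff)
        then show ?thesis by (subst AE_iff_measurable[OF _ refl]) (auto simp: emeasure_eq_measure)
      qed
      have "\<forall>\<^sub>F i in F. \<not> (prob (D' \<inter> {x. k i x < a}) > 0 \<and> prob (D' \<inter> {x. b < k i x}) > 0)"
        using ultra n unfolding splits_def by blast
      then have "\<forall>\<^sub>F i in F. (AE x in M. x \<in> D' \<longrightarrow> a \<le> k i x) \<or> (AE x in M. x \<in> D' \<longrightarrow> k i x \<le> b)"
      proof eventually_elim
        case (elim i)
        then consider "\<not> prob (D' \<inter> {x. k i x < a}) > 0" | "\<not> prob (D' \<inter> {x. b < k i x}) > 0" by blast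
        then show ?case
        proof cases
          case 1
          have "AE x in M. x \<in> D' \<longrightarrow> \<not> k i x < a" by (rule null[OF 1]) measurable
          then show ?thesis by (simp add: not_less)
        next
          case 2
          have "AE x in M. x \<in> D' \<longrightarrow> \<not> b < k i x" by (rule null[OF 2]) measurable
          then show ?thesis by (simp add: not_less)
        qed
      qed
      from disj[OF this] D' show ?thesis by blast
    qed
    have narrow: "\<exists>D'\<in>sets M. D' \<subseteq> D \<and> prob D' > 0 \<and>
        (\<exists>l. \<forall>\<^sub>F i in F. AE x in M. x \<in> D' \<longrightarrow> l \<le> k i x \<and> k i x \<le> l + (2/3) ^ n)"
      if D: "D \<in> sets M" "prob D > 0" for D n
    proof (induction n)
      case 0
      show ?case using D kb by (intro bexI[of _ D]) (auto intro!: exI[of _ 0])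
    next
      case (Suc n)
      then obtain D' l where D': "D' \<in> sets M" "D' \<subseteq> D" "prob D' > 0"
        and l: "\<forall>\<^sub>F i in F. AE x in M. x \<in> D' \<longrightarrow> l \<le> k i x \<and> k i x \<le> l + (2/3) ^ n" by blast
      define w :: real where "w = (2/3) ^ n"
      have w: "w > 0" by (simp add: w_def)
      obtain D'' where D'': "D'' \<in> sets M" "D'' \<subseteq> D'" "prob D'' > 0" and
        alt: "(\<forall>\<^sub>F i in F. AE x in M. x \<in> D'' \<longrightarrow> l + w/3 \<le> k i x) \<or>
              (\<forall>\<^sub>F i in F. AE x in M. x \<in> D'' \<longrightarrow> k i x \<le> l + 2*w/3)"
        using half[of "l + w/3" "l + 2*w/3" D'] D' w by auto
      have "\<exists>l. \<forall>\<^sub>F i in F. AE x in M. x \<in> D'' \<longrightarrow> l \<le> k i x \<and> k i x \<le> l + 2*w/3"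
        using alt
      proof
        assume "\<forall>\<^sub>F i in F. AE x in M. x \<in> D'' \<longrightarrow> l + w/3 \<le> k i x"
        with l have "\<forall>\<^sub>F i in F. AE x in M. x \<in> D'' \<longrightarrow> l + w/3 \<le> k i x \<and> k i x \<le> (l + w/3) + 2*w/3"
        proof eventually_elim
          case (elim i)
          from elim(1,2) show ?case
            by eventually_elim (use D''(2) in \<open>auto simp: w_def\<close>)
        qed
        then show ?thesis by blast
      next
        assume "\<forall>\<^sub>F i in F. AE x in M. x \<in> D'' \<longrightarrow> k i x \<le> l + 2*w/3"
        with l have "\<forall>\<^sub>F i in F. AE x in M. x \<in> D'' \<longrightarrow> l \<le> k i x \<and> k i x \<le> l + 2*w/3"
        proof eventually_elim
          case (elim i)
          from elim(1,2) show ?case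
            by eventually_elim (use D''(2) in \<open>auto simp: w_def\<close>)
        qed
        then show ?thesis by blast
      qed
      then show ?case using D'' D'(2) by (intro bexI[of _ D'']) (auto simp: w_def)
    qed
    define good where "good D = (D \<in> sets M \<and>
        (\<forall>\<^sub>F i in F. \<forall>\<^sub>F j in F. AE x in M. x \<in> D \<longrightarrow> \<bar>k i x - k j x\<bar> \<le> \<epsilon>))" for D
    have ex_good: "\<exists>D'. good D' \<and> D' \<subseteq> D \<and> prob D' > 0" if D: "D \<in> sets M" "prob D > 0" for D
    proof -
      obtain n where n: "(2/3 :: real) ^ n < \<epsilon>" using real_arch_pow_inv[OF \<epsilon>, of "2/3"] by auto
      obtain D' l where D': "D' \<in> sets M" "D' \<subseteq> D" "prob D' > 0"
        and l: "\<forall>\<^sub>F i in F. AE x in M. x \<in> D' \<longrightarrow> l \<le> k i x \<and> k i x \<le> l + (2/3) ^ n"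
        using narrow[OF D] by blast
      have "\<forall>\<^sub>F i in F. \<forall>\<^sub>F j in F. AE x in M. x \<in> D' \<longrightarrow> \<bar>k i x - k j x\<bar> \<le> \<epsilon>"
        using l
      proof eventually_elim
        case i: (elim i)
        show ?case using l
        proof eventually_elim
          case (elim j)
          from i elim show ?case by eventually_elim (use n in auto)
        qed
      qed
      then show ?thesis using D' by (auto simp: good_def)
    qed
    have good_Un: "good (D \<union> E)" if "good D" "good E" for D E
    proof -
      have D: "\<forall>\<^sub>F i in F. \<forall>\<^sub>F j in F. AE x in M. x \<in> D \<longrightarrow> \<bar>k i x - k j x\<bar> \<le> \<epsilon>"
        and E: "\<forall>\<^sub>F i in F. \<forall>\<^sub>F j in F. AE x in M. x \<in> E \<longrightarrow> \<bar>k i x - k j x\<bar> \<le> \<epsilon>"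
        using that by (auto simp: good_def)
      have "\<forall>\<^sub>F i in F. \<forall>\<^sub>F j in F. AE x in M. x \<in> D \<union> E \<longrightarrow> \<bar>k i x - k j x\<bar> \<le> \<epsilon>"
        using D E
      proof eventually_elim
        case i: (elim i)
        show ?case using i
        proof eventually_elim
          case (elim j)
          from elim show ?case by eventually_elim auto
        qed
      qed
      then show ?thesis using that by (auto simp: good_def)
    qed
    (* Exhaustion: a countable union of good sets that nearly attain the supremum has full measure,
       since a good set in its complement could be added to one of them. *)
    define s where "s = Sup (prob ` Collect good)"
    have bdd: "bdd_above (prob ` Collect good)" by (rule bdd_aboveI[of _ 1]) auto
    have "good {}" by (auto simp: good_def)
    then have ne: "prob ` Collect good \<noteq> {}" by auto
    have le_s: "prob D \<le> s" if "good D" for D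
      unfolding s_def using that by (intro cSup_upper bdd) auto
    have "\<exists>D. good D \<and> prob D > s - 1 / Suc n" for n
      using less_cSup_iff[OF ne bdd, of "s - 1 / Suc n"] unfolding s_def by auto
    then obtain D where D: "\<And>n. good (D n)" "\<And>n. prob (D n) > s - 1 / Suc n" by metis
    have [measurable]: "D n \<in> sets M" for n using D(1)[of n] by (simp add: good_def)
    define E where "E n = (\<Union>m\<le>n. D m)" for n
    have gE: "good (E n)" for n
      by (induction n) (auto simp: E_def atMost_Suc D(1) good_Un)
    have full: "prob (\<Union>n. D n) = 1"
    proof (rule ccontr)
      assume "prob (\<Union>n. D n) \<noteq> 1"
      then have "prob (\<Union>n. D n) < 1" using prob_le_1[of "\<Union>n. D n"] by linarith
      then have "prob (space M - (\<Union>n. D n)) > 0" by (subst prob_compl) auto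
      moreover have "space M - (\<Union>n. D n) \<in> sets M" by measurable
      ultimately obtain D' where D': "good D'" "D' \<subseteq> space M - (\<Union>n. D n)" "prob D' > 0"
        using ex_good by blast
      obtain n where n: "1 / Suc n < prob D'" using D'(3) nat_approx_posE by blast
      have "prob (D n \<union> D') = prob (D n) + prob D'"
        using D'(1,2) by (intro finite_measure_Union) (auto simp: good_def)
      moreover have "prob (D n \<union> D') \<le> s" by (intro le_s good_Un D(1) D'(1))
      ultimately show False using D(2)[of n] n by simp
    qed
    have "(\<lambda>n. prob (E n)) \<longlonglongrightarrow> prob (\<Union>n. E n)"
      by (rule finite_Lim_measure_incseq) (auto simp: E_def incseq_def, fastforce)
    moreover have "(\<Union>n. E n) = (\<Union>n. D n)" by (auto simp: E_def)
    ultimately have "(\<lambda>n. prob (E n)) \<longlonglongrightarrow> 1" using full by simp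
    then have "\<forall>\<^sub>F n in sequentially. prob (E n) > 1 - \<epsilon>" by (rule order_tendstoD(1)) (use \<epsilon> in simp)
    then obtain n where "prob (E n) > 1 - \<epsilon>" by (auto simp: eventually_sequentially)
    then show ?thesis using gE[of n] close unfolding good_def by blast
  qed
qed

section \<open>Passing from midpoint averages back to the functions\<close>

text \<open>
  The counterpart for independence of the fact that weak precompactness passes to convex hulls. A
  section \<open>z\<close> of the cells transports everything to the coin-flip space, where \<open>\<psi> i \<circ> z\<close> has correlation
  at least \<open>(b - a) / 2\<close> with the \<open>i\<close>-th Rademacher function. Correlation is affine, so some member \<open>h i\<close>
  of \<open>S\<close> has it too. If the \<open>h i \<circ> z\<close> were nearly equal along an ultrafilter, a single one of them would
  correlate with arbitrarily many orthonormal functions, against Bessel's inequality; hence they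
  split every subset of positive probability of some event, infinitely often, and cells of positive
  probability are nonempty.
\<close>

lemma independent_seq_midpoint_hull:
  fixes S :: "('x::topological_space \<Rightarrow> real) set"
  assumes cpt: "compact (UNIV :: 'x set)"
    and cont: "\<And>h. h \<in> S \<Longrightarrow> continuous_on UNIV h"
    and unit: "\<And>h x. h \<in> S \<Longrightarrow> 0 \<le> h x \<and> h x \<le> 1"
    and \<psi>: "\<And>i. \<psi> i \<in> midpoint_hull S" and ind: "independent_seq \<psi> a b" and ab: "a < b"
  obtains h c d where "\<And>i. h i \<in> S" "c < d" "independent_seq h c d"
proof -
  have "\<exists>T\<subseteq>S. countable T \<and> \<psi> i \<in> midpoint_hull T" for i
    using midpoint_hull_countable[OF \<psi>] by blast
  then obtain T' where T': "\<And>i. T' i \<subseteq> S \<and> countable (T' i) \<and> \<psi> i \<in> midpoint_hull (T' i)"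
    by metis
  define T where "T = (\<Union>i. T' i)"
  have T: "T \<subseteq> S" "countable T" and \<psi>T: "\<And>i. \<psi> i \<in> midpoint_hull T"
    using T' by (auto simp: T_def intro: midpoint_hull_mono)
  (* Knowing in which of these countably many closed sets a point lies determines h at it for all h in T. *)
  define \<C> where "\<C> = (\<lambda>(h, q). {x. h x \<ge> (of_rat q :: real)}) ` (T \<times> (UNIV :: rat set))"
  have \<C>: "countable \<C>" unfolding \<C>_def using T by auto
  have "T \<noteq> {}"
  proof
    assume "T = {}"
    moreover have "\<psi> \<in> midpoint_hull {} \<Longrightarrow> False" for \<psi> :: "'x \<Rightarrow> real"
      by (induction rule: midpoint_hull.induct) auto
    ultimately show False using \<psi>T[of 0] by auto
  qed
  then have \<C>_ne: "\<C> \<noteq> {}" by (auto simp: \<C>_def)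
  have closed_ge: "closed {x. h x \<ge> c}" and closed_le: "closed {x. h x \<le> c}"
    if "continuous_on UNIV h" for h :: "'x \<Rightarrow> real" and c
    using that by (auto intro!: closed_Collect_le continuous_intros)
  have \<psi>_cont: "continuous_on UNIV (\<psi> i)" for i
    using midpoint_hull_continuous[OF \<psi>] cont by blast
  define P where "P i \<beta> = (if \<beta> then {x. b \<le> \<psi> i x} else {x. \<psi> i x \<le> a})" for i \<beta>
  obtain z where zP: "\<And>\<sigma> i. z \<sigma> \<in> P i (\<sigma> i)"
    and zC: "\<And>j. {\<sigma>. z \<sigma> \<in> from_nat_into \<C> j} \<in> sets coin_flips"
  proof (rule measurable_section[OF cpt, where P = P and C = "from_nat_into \<C>" and M = coin_flips])
    show "closed (P i \<beta>)" for i \<beta> by (auto simp: P_def intro!: closed_ge closed_le \<psi>_cont)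
    have "closed C" if "C \<in> \<C>" for C
      using that T cont closed_ge by (auto simp: \<C>_def)
    then show "closed (from_nat_into \<C> j)" for j using from_nat_into[OF \<C>_ne] by blast
    show "\<exists>x. \<forall>i<n. x \<in> P i (\<sigma> i)" for \<sigma> n
    proof -
      obtain x where "\<forall>i<n. if \<sigma> i then b < \<psi> i x else \<psi> i x < a"
        using ind unfolding independent_seq_def by blast
      then have "\<forall>i<n. x \<in> P i (\<sigma> i)" by (auto simp: P_def less_imp_le)
      then show ?thesis ..
    qed
  qed (use space_coin_flips heads_sets in auto)
  have meas: "(\<lambda>\<sigma>. h (z \<sigma>)) \<in> borel_measurable coin_flips" if "h \<in> T" for h
  proof (rule borel_measurable_iff_ge[THEN iffD2], intro allI)
    have rat: "{\<sigma>. h (z \<sigma>) \<ge> of_rat q} \<in> sets coin_flips" for q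
    proof -
      have "{x. h x \<ge> of_rat q} \<in> \<C>" unfolding \<C>_def using that by force
      then obtain j where "from_nat_into \<C> j = {x. h x \<ge> of_rat q}"
        using from_nat_into_surj[OF \<C>] by blast
      then show ?thesis using zC[of j] by simp
    qed
    fix c :: real
    have "{\<sigma> \<in> space coin_flips. c \<le> h (z \<sigma>)} = (\<Inter>q\<in>{q. of_rat q < c}. {\<sigma>. h (z \<sigma>) \<ge> of_rat q})"
    proof (intro Set.set_eqI iffI)
      fix \<sigma> assume *: "\<sigma> \<in> (\<Inter>q\<in>{q. of_rat q < c}. {\<sigma>. h (z \<sigma>) \<ge> of_rat q})"
      have "c \<le> h (z \<sigma>)"
      proof (rule ccontr)
        assume "\<not> c \<le> h (z \<sigma>)"
        then obtain q where "h (z \<sigma>) < of_rat q" "of_rat q < c"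
          using of_rat_dense[of "h (z \<sigma>)" c] by auto
        then show False using * by auto
      qed
      then show "\<sigma> \<in> {\<sigma> \<in> space coin_flips. c \<le> h (z \<sigma>)}" by (simp add: space_coin_flips)
    qed (auto simp: space_coin_flips)
    also have "\<dots> \<in> sets coin_flips"
    proof (rule sets.countable_INT'')
      show "UNIV \<in> sets coin_flips" using sets.top[of coin_flips] by (simp add: space_coin_flips)
    qed (use rat in auto)
    finally show "{\<sigma> \<in> space coin_flips. c \<le> h (z \<sigma>)} \<in> sets coin_flips" .
  qed
  have hull_meas: "(\<lambda>\<sigma>. \<xi> (z \<sigma>)) \<in> borel_measurable coin_flips" if "\<xi> \<in> midpoint_hull T" for \<xi>
    using that by induction (use meas in auto)
  have hull_unit: "0 \<le> \<xi> x \<and> \<xi> x \<le> 1" if "\<xi> \<in> midpoint_hull T" for \<xi> x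
    using midpoint_hull_unit_interval[OF that] unit T by blast
  have rad_abs: "\<bar>rademacher i \<sigma>\<bar> = 1" for i \<sigma> by (simp add: rademacher_def)
  have int: "integrable coin_flips (\<lambda>\<sigma>. \<xi> (z \<sigma>) * rademacher i \<sigma>)" if "\<xi> \<in> midpoint_hull T" for \<xi> i
  proof (rule coin_flips.integrable_const_bound[where B = 1])
    show "AE \<sigma> in coin_flips. norm (\<xi> (z \<sigma>) * rademacher i \<sigma>) \<le> 1"
      using hull_unit[OF that] by (auto simp: abs_mult rad_abs)
  qed (use hull_meas[OF that] in measurable)
  define L where "L i \<xi> = coin_flips.expectation (\<lambda>\<sigma>. \<xi> (z \<sigma>) * rademacher i \<sigma>)" for i \<xi>
  have int_rad: "integrable coin_flips (rademacher i)" for i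
    by (rule coin_flips.integrable_const_bound[where B = 1]) (auto simp: rad_abs)
  have E_rad: "coin_flips.expectation (rademacher i) = 0" for i
  proof -
    have eq: "rademacher i = (\<lambda>\<sigma>. 2 * indicat_real {\<sigma>. \<sigma> i} \<sigma> - 1)"
      by (auto simp: rademacher_def indicator_def)
    have "integrable coin_flips (indicat_real {\<sigma>. \<sigma> i})"
      using heads_sets[of i] by (simp add: less_top[symmetric])
    then show ?thesis unfolding eq
      using coin_flips_heads[of "{i}"] coin_flips.prob_space
      by (simp add: space_coin_flips)
  qed
  have "(b - a) / 2 \<le> L i (\<psi> i)" for i
  proof -
    have "(b - a) / 2 = coin_flips.expectation (\<lambda>\<sigma>. (b - a) / 2 + (a + b) / 2 * rademacher i \<sigma>)"
      using int_rad[of i] coin_flips.prob_space by (simp add: E_rad)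
    also have "\<dots> \<le> L i (\<psi> i)"
      unfolding L_def
    proof (rule integral_mono[OF _ int[OF \<psi>T]])
      show "(b - a) / 2 + (a + b) / 2 * rademacher i \<sigma> \<le> \<psi> i (z \<sigma>) * rademacher i \<sigma>" for \<sigma>
        using zP[of \<sigma> i] by (auto simp: P_def rademacher_def field_simps split: if_splits)
    qed (use int_rad in auto)
    finally show ?thesis .
  qed
  moreover have "L i (\<lambda>x. (\<psi> x + \<xi> x) / 2) = (L i \<psi> + L i \<xi>) / 2"
    if "\<psi> \<in> midpoint_hull T" "\<xi> \<in> midpoint_hull T" for i \<psi> \<xi>
  proof -
    have "L i (\<lambda>x. (\<psi> x + \<xi> x) / 2)
      = coin_flips.expectation (\<lambda>\<sigma>. (\<psi> (z \<sigma>) * rademacher i \<sigma> + \<xi> (z \<sigma>) * rademacher i \<sigma>) / 2)"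
      unfolding L_def by (rule arg_cong[where f = coin_flips.expectation]) (auto simp: field_simps)
    then show ?thesis using int[OF that(1), of i] int[OF that(2), of i] by (simp add: L_def)
  qed
  ultimately have "\<exists>h\<in>T. (b - a) / 2 \<le> L i h" for i
    by (intro midpoint_hull_ge[where L = "L i", OF \<psi>T])
  then obtain h where hT: "\<And>i. h i \<in> T" and hL: "\<And>i. (b - a) / 2 \<le> L i (h i)" by metis
  have hS: "h i \<in> S" for i using hT T by auto
  have hH: "h i \<in> midpoint_hull T" for i using hT by (rule midpoint_hull.base)
  define k where "k i \<sigma> = h i (z \<sigma>)" for i \<sigma>
  have k[measurable]: "k i \<in> borel_measurable coin_flips" for i unfolding k_def by (rule meas[OF hT])
  have kb: "0 \<le> k i \<sigma> \<and> k i \<sigma> \<le> 1" for i \<sigma> unfolding k_def by (rule hull_unit[OF hH])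
  obtain F :: "nat filter" where F: "F \<noteq> bot" "F \<le> sequentially"
    and ultra: "\<And>P. eventually P F \<or> eventually (\<lambda>i. \<not> P i) F"
    using free_ultrafilter_exists by blast
  (* Replacing k j by a close k i costs at most 2 * \<epsilon> of the correlation (b - a) / 2 = 4 * \<epsilon>. *)
  define \<epsilon> where "\<epsilon> = (b - a) / 8"
  have \<epsilon>: "\<epsilon> > 0" using ab by (simp add: \<epsilon>_def)
  show ?thesis
  proof (rule coin_flips.independent_or_close[OF k kb ultra \<epsilon>])
    fix c d D
    assume cd: "c < d" and D: "D \<in> sets coin_flips" "coin_flips.prob D > 0"
      and split: "\<And>D'. D' \<in> sets coin_flips \<Longrightarrow> D' \<subseteq> D \<Longrightarrow> coin_flips.prob D' > 0 \<Longrightarrow>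
        \<forall>\<^sub>F i in F. coin_flips.prob (D' \<inter> {x. k i x < c}) > 0 \<and> coin_flips.prob (D' \<inter> {x. d < k i x}) > 0"
    have sets: "{\<sigma>. k i \<sigma> < c} \<in> sets coin_flips" "{\<sigma>. d < k i \<sigma>} \<in> sets coin_flips" for i
      using measurable_sets[OF k, of "{..<c}" i] measurable_sets[OF k, of "{d<..}" i]
      by (auto simp: vimage_def space_coin_flips)
    define big where "big E \<longleftrightarrow> E \<in> sets coin_flips \<and> coin_flips.prob E > 0" for E
    have "\<exists>r :: nat \<Rightarrow> nat. \<forall>\<sigma> n. big (D \<inter> {x. \<forall>i<n. if \<sigma> i then x \<in> {x. d < k (r i) x} else x \<in> {x. k (r i) x < c}})"
    proof (rule independent_subsequence[OF F, where big = big and A = "\<lambda>i. {x. k i x < c}" and B = "\<lambda>i. {x. d < k i x}"])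
      show "big D" using D by (simp add: big_def)
    next
      fix E assume E: "big E" "E \<subseteq> D"
      then have "\<forall>\<^sub>F i in F. coin_flips.prob (E \<inter> {x. k i x < c}) > 0 \<and> coin_flips.prob (E \<inter> {x. d < k i x}) > 0"
        using split unfolding big_def by blast
      then show "\<forall>\<^sub>F i in F. big (E \<inter> {x. k i x < c}) \<and> big (E \<inter> {x. d < k i x})"
        by eventually_elim (use E sets in \<open>simp add: big_def sets.Int\<close>)
    qed
    then obtain r :: "nat \<Rightarrow> nat" where r: "\<And>\<sigma> n. big (D \<inter> {x. \<forall>i<n. if \<sigma> i then x \<in> {x. d < k (r i) x} else x \<in> {x. k (r i) x < c}})"
      by blast
    have "independent_seq (\<lambda>i. h (r i)) c d"
      unfolding independent_seq_def
    proof (intro allI)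
      fix \<sigma> n
      have "D \<inter> {x. \<forall>i<n. if \<sigma> i then x \<in> {x. d < k (r i) x} else x \<in> {x. k (r i) x < c}} \<noteq> {}"
        using r[of n \<sigma>] unfolding big_def by (metis measure_empty less_irrefl)
      then obtain \<tau> where "\<forall>i<n. if \<sigma> i then d < k (r i) \<tau> else k (r i) \<tau> < c"
        unfolding mem_Collect_eq by blast
      then show "\<exists>x. \<forall>i<n. if \<sigma> i then d < h (r i) x else h (r i) x < c"
        unfolding k_def by (rule exI)
    qed
    then show ?thesis using that[of "\<lambda>i. h (r i)"] hS cd by blast
  next
    fix D assume D: "D \<in> sets coin_flips" "coin_flips.prob D > 1 - \<epsilon>"
      and close: "\<forall>\<^sub>F i in F. \<forall>\<^sub>F j in F. AE x in coin_flips. x \<in> D \<longrightarrow> \<bar>k i x - k j x\<bar> \<le> \<epsilon>"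
    obtain i where i: "\<forall>\<^sub>F j in F. AE x in coin_flips. x \<in> D \<longrightarrow> \<bar>k i x - k j x\<bar> \<le> \<epsilon>"
      using eventually_happens'[OF F(1) close] by blast
    define I where "I = {j. AE x in coin_flips. x \<in> D \<longrightarrow> \<bar>k i x - k j x\<bar> \<le> \<epsilon>}"
    have "infinite I"
    proof
      assume "finite I"
      then obtain N where N: "\<forall>j\<in>I. j < N" using finite_nat_set_iff_bounded by auto
      have "\<forall>\<^sub>F j in F. N \<le> j"
        using F(2) eventually_ge_at_top by (rule filter_leD)
      with i have "\<forall>\<^sub>F j in F. j \<in> I \<and> N \<le> j"
        by eventually_elim (simp add: I_def)
      from eventually_happens'[OF F(1) this] show False using N by auto
    qed
    obtain n :: nat where n: "real n * (2 * \<epsilon>)\<^sup>2 > 1"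
      using reals_Archimedean3[of "(2 * \<epsilon>)\<^sup>2"] \<epsilon> by auto
    obtain J where J: "finite J" "card J = n" "J \<subseteq> I"
      using infinite_arbitrarily_large[OF \<open>infinite I\<close>] by blast
    have kint: "integrable coin_flips (\<lambda>\<sigma>. k i \<sigma> * rademacher j \<sigma>)" for i j
      unfolding k_def by (rule int[OF hH])
    have "2 * \<epsilon> \<le> coin_flips.expectation (\<lambda>\<sigma>. k i \<sigma> * rademacher j \<sigma>)" if "j \<in> J" for j
    proof -
      have ae: "AE x in coin_flips. x \<in> D \<longrightarrow> \<bar>k i x - k j x\<bar> \<le> \<epsilon>" using that J(3) by (auto simp: I_def)
      have bound: "AE x in coin_flips. k j x * rademacher j x - k i x * rademacher j x \<le> \<epsilon> + indicat_real (space coin_flips - D) x"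
        using ae
      proof eventually_elim
        case (elim x)
        then show ?case using kb[of i x] kb[of j x] \<epsilon>
          by (auto simp: rademacher_def indicator_def space_coin_flips abs_le_iff)
      qed
      have Dc: "space coin_flips - D \<in> sets coin_flips" using D by auto
      have Dcint: "integrable coin_flips (indicat_real (space coin_flips - D))"
        using Dc by (simp add: less_top[symmetric])
      have "4 * \<epsilon> \<le> L j (h j)" using hL[of j] by (simp add: \<epsilon>_def)
      also have "L j (h j) = coin_flips.expectation (\<lambda>\<sigma>. k j \<sigma> * rademacher j \<sigma>)"
        by (simp add: L_def k_def)
      also have "\<dots> - coin_flips.expectation (\<lambda>\<sigma>. k i \<sigma> * rademacher j \<sigma>)
        = coin_flips.expectation (\<lambda>\<sigma>. k j \<sigma> * rademacher j \<sigma> - k i \<sigma> * rademacher j \<sigma>)"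
        using kint by simp
      also have "\<dots> \<le> coin_flips.expectation (\<lambda>\<sigma>. \<epsilon> + indicat_real (space coin_flips - D) \<sigma>)"
        by (rule integral_mono_AE) (use kint Dcint bound in auto)
      also have "\<dots> = \<epsilon> + coin_flips.prob (space coin_flips - D)"
        using Dcint Dc coin_flips.prob_space by (simp add: Int_absorb2)
      also have "\<dots> \<le> 2 * \<epsilon>" using coin_flips.prob_compl[OF D(1)] D(2) by simp
      finally show ?thesis by simp
    qed
    then have "card J * (2 * \<epsilon>)\<^sup>2 \<le> 1"
      by (intro coin_flips.bessel_bound[of "k i" rademacher] k kb rademacher_measurable rademacher_orthonormal J)
         (use \<epsilon> in \<open>auto simp: rad_abs\<close>)
    then show ?thesis using n J(2) by simp
  qed
qed

section \<open>Independence contradicts fragmentability\<close>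

lemma compact_uniformly_close:
  fixes f :: "'x::uniform_space \<Rightarrow> real"
  assumes cpt: "compact (UNIV :: 'x set)" and f: "continuous_on UNIV f" and \<epsilon>: "\<epsilon> > 0"
  shows "\<forall>\<^sub>F p in uniformity. \<bar>f (fst p) - f (snd p)\<bar> < \<epsilon>"
proof -
  have "\<exists>D U. eventually D uniformity \<and> open U \<and> x \<in> U \<and>
      (\<forall>y\<in>U. \<forall>z. D (y, z) \<longrightarrow> \<bar>f y - f z\<bar> < \<epsilon>)" for x
  proof -
    have "\<forall>\<^sub>F y in nhds x. \<bar>f y - f x\<bar> < \<epsilon> / 2"
    proof -
      have "filterlim f (nhds (f x)) (nhds x)"
        using f by (simp add: continuous_on_def flip: tendsto_at_iff_tendsto_nhds)
      then show ?thesis using tendstoD[of f "f x" "nhds x" "\<epsilon>/2"] \<epsilon> by (simp add: dist_real_def)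
    qed
    then have "\<forall>\<^sub>F p in uniformity. (\<lambda>(x', y). x' = x \<longrightarrow> \<bar>f y - f x\<bar> < \<epsilon> / 2) p"
      by (simp add: eventually_nhds_uniformity)
    then obtain D where D: "eventually D uniformity"
      and tr: "\<And>u v w. D (u, v) \<Longrightarrow> D (v, w) \<Longrightarrow> (\<lambda>(x', y). x' = x \<longrightarrow> \<bar>f y - f x\<bar> < \<epsilon> / 2) (u, w)"
      by (rule uniformity_transE) blast
    have "\<forall>\<^sub>F y in nhds x. D (x, y)"
      unfolding eventually_nhds_uniformity using D by eventually_elim auto
    then obtain U where U: "open U" "x \<in> U" "\<And>y. y \<in> U \<Longrightarrow> D (x, y)"
      unfolding eventually_nhds by blast
    have refl: "D (y, y)" for y using D by (rule uniformity_refl)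
    have "\<bar>f y - f z\<bar> < \<epsilon>" if "y \<in> U" "D (y, z)" for y z
    proof -
      have "\<bar>f y - f x\<bar> < \<epsilon> / 2" "\<bar>f z - f x\<bar> < \<epsilon> / 2"
        using tr[OF U(3)[OF that(1)] refl] tr[OF U(3)[OF that(1)] that(2)] by auto
      then show ?thesis by linarith
    qed
    then show ?thesis using D U(1,2) by blast
  qed
  then obtain D U where DU: "\<And>x. eventually (D x) uniformity" "\<And>x. open (U x)" "\<And>x. x \<in> U x"
    "\<And>x y z. y \<in> U x \<Longrightarrow> D x (y, z) \<Longrightarrow> \<bar>f y - f z\<bar> < \<epsilon>" by metis
  have "UNIV \<subseteq> (\<Union>x\<in>UNIV. U x)" using DU(3) by blast
  then obtain J where J: "finite J" "UNIV \<subseteq> (\<Union>x\<in>J. U x)"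
    using compactE_image[OF cpt, of UNIV U] DU(2) by metis
  have "\<forall>\<^sub>F p in uniformity. \<forall>x\<in>J. D x p"
    using J(1) DU(1) by (intro eventually_ball_finite) auto
  then show ?thesis
  proof eventually_elim
    case (elim p)
    obtain x where "x \<in> J" "fst p \<in> U x" using J(2) by blast
    then show ?case using elim DU(4)[of "fst p" x "snd p"] by simp
  qed
qed

text \<open>
  Zorn's lemma, applied to the open complements of the closed sets that meet every fibre \<open>\<Inter>i. P i (\<sigma> i)\<close>; a chain of them has an
  intersection with the same property because the fibres are compact.
\<close>

lemma irreducible_closed_subset:
  fixes P :: "nat \<Rightarrow> bool \<Rightarrow> 'x::topological_space set"
  assumes cpt: "compact (UNIV :: 'x set)" and P: "\<And>i \<beta>. closed (P i \<beta>)"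
    and ne: "\<And>\<sigma> n. \<exists>x. \<forall>i<n. x \<in> P i (\<sigma> i)"
  obtains A where "closed A" "\<And>\<sigma>. \<exists>x\<in>A. \<forall>i. x \<in> P i (\<sigma> i)"
    "\<And>B. closed B \<Longrightarrow> B \<subset> A \<Longrightarrow> \<exists>\<sigma>. \<not> (\<exists>x\<in>B. \<forall>i. x \<in> P i (\<sigma> i))"
proof -
  define onto where "onto A \<longleftrightarrow> closed A \<and> (\<forall>\<sigma>. \<exists>x\<in>A. \<forall>i. x \<in> P i (\<sigma> i))" for A
  have "onto UNIV"
    unfolding onto_def
  proof (intro conjI allI)
    fix \<sigma> show "\<exists>x\<in>UNIV. \<forall>i. x \<in> P i (\<sigma> i)"
      by (rule closed_sets_meet[OF cpt]) (use P ne in auto)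
  qed simp
  have "\<exists>M\<in>{U. onto (- U)}. \<forall>X\<in>{U. onto (- U)}. M \<subseteq> X \<longrightarrow> X = M"
  proof (rule subset_Zorn_nonempty)
    show "{U. onto (- U)} \<noteq> {}" using \<open>onto UNIV\<close> by (auto intro!: exI[of _ "{}"])
  next
    fix \<C> assume \<C>: "\<C> \<noteq> {}" "subset.chain {U. onto (- U)} \<C>"
    have on: "onto (- U)" if "U \<in> \<C>" for U using \<C>(2) that by (auto simp: subset.chain_def)
    have "\<exists>x\<in>- \<Union>\<C>. \<forall>i. x \<in> P i (\<sigma> i)" for \<sigma>
    proof -
      define fib where "fib = (\<Inter>i. P i (\<sigma> i))"
      have "UNIV \<inter> (\<Inter>U\<in>\<C>. fib \<inter> (- U)) \<noteq> {}"
      proof (rule compact_imp_fip_image[OF cpt])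
        show "closed (fib \<inter> (- U))" if "U \<in> \<C>" for U
          using on[OF that] P by (auto simp: onto_def fib_def intro!: closed_Int)
      next
        fix I assume I: "finite I" "I \<subseteq> \<C>"
        show "UNIV \<inter> (\<Inter>U\<in>I. fib \<inter> (- U)) \<noteq> {}"
        proof (cases "I = {}")
          case False
          have "subset.chain {U. onto (- U)} I"
            using I(2) \<C>(2) unfolding subset.chain_def by blast
          then have "\<Union>I \<in> \<C>"
            using Union_in_chain[OF I(1) False] I(2) by blast
          then obtain x where "x \<in> - \<Union>I" "\<forall>i. x \<in> P i (\<sigma> i)" using on unfolding onto_def by blast
          then show ?thesis by (auto simp: fib_def)
        qed simp
      qed
      then show ?thesis using \<C>(1) by (auto simp: fib_def)
    qed
    moreover have "closed (- \<Union>\<C>)" using on by (auto simp: onto_def closed_def)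
    ultimately show "\<Union>\<C> \<in> {U. onto (- U)}" by (simp add: onto_def)
  qed
  then obtain M where M: "onto (- M)" "\<And>X. onto (- X) \<Longrightarrow> M \<subseteq> X \<Longrightarrow> X = M" by blast
  show ?thesis
  proof (rule that[of "- M"])
    fix B assume B: "closed B" "B \<subset> - M"
    have "\<not> onto B" using M(2)[of "- B"] B(2) by auto
    then show "\<exists>\<sigma>. \<not> (\<exists>x\<in>B. \<forall>i. x \<in> P i (\<sigma> i))" using B(1) by (auto simp: onto_def)
  qed (use M(1) in \<open>auto simp: onto_def\<close>)
qed

text \<open>
  On an irreducible closed set \<open>A\<close> lying over the Cantor set, every nonempty relatively open \<open>U\<close>
  contains all points of \<open>A\<close> over some cylinder. A cylinder contains sequences that are eventually
  false and sequences that are eventually true, and at points over these a cluster point \<open>p\<close> of the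
  \<open>g i\<close> has \<open>f (p x) \<le> a\<close> and \<open>f (p y) \<ge> b\<close>, respectively. So \<open>f \<circ> p\<close> oscillates by at least \<open>b - a\<close> on
  every such \<open>U\<close>.
\<close>

lemma independent_cluster_point_not_fragmented:
  fixes f :: "'x::uniform_space \<Rightarrow> real" and g :: "nat \<Rightarrow> 'x \<Rightarrow> 'x"
  assumes cpt: "compact (UNIV :: 'x set)" and f: "continuous_on UNIV f"
    and g: "\<And>i. continuous_on UNIV (g i)"
    and ind: "independent_seq (\<lambda>i x. f (g i x)) a b" and ab: "a < b"
    and p: "\<And>n. p \<in> closure (g ` {n..})"
  shows "\<not> fragmented p"
proof
  assume frag: "fragmented p"
  define P where "P i \<beta> = (if \<beta> then {x. b \<le> f (g i x)} else {x. f (g i x) \<le> a})" for i \<beta>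
  have fg: "continuous_on UNIV (\<lambda>x. f (g i x))" for i
    using continuous_on_compose2[OF f g[of i]] by simp
  have P: "closed (P i \<beta>)" for i \<beta>
    using fg by (auto simp: P_def intro!: closed_Collect_le continuous_intros)
  have ne: "\<exists>x. \<forall>i<n. x \<in> P i (\<sigma> i)" for \<sigma> n
  proof -
    obtain x where "\<forall>i<n. if \<sigma> i then b < f (g i x) else f (g i x) < a"
      using ind unfolding independent_seq_def by blast
    then have "\<forall>i<n. x \<in> P i (\<sigma> i)" by (auto simp: P_def less_imp_le)
    then show ?thesis ..
  qed
  obtain A where A: "closed A" "\<And>\<sigma>. \<exists>x\<in>A. \<forall>i. x \<in> P i (\<sigma> i)"
    and irr: "\<And>B. closed B \<Longrightarrow> B \<subset> A \<Longrightarrow> \<exists>\<sigma>. \<not> (\<exists>x\<in>B. \<forall>i. x \<in> P i (\<sigma> i))"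
    by (rule irreducible_closed_subset[OF cpt P ne]) (rule that)
  define V where "V = {p. \<bar>f (fst p) - f (snd p)\<bar> < b - a}"
  have "\<forall>\<^sub>F p in uniformity. p \<in> V"
    using compact_uniformly_close[OF cpt f, of "b - a"] ab by (simp add: V_def)
  moreover have "A \<noteq> {}" using A(2) by blast
  ultimately obtain U where U: "openin (top_of_set A) U" "U \<noteq> {}" "\<forall>x\<in>U. \<forall>y\<in>U. (p x, p y) \<in> V"
    using frag unfolding fragmented_def by blast
  obtain T where T: "open T" "U = A \<inter> T" using U(1) by (auto simp: openin_open)
  have cAT: "closed (A - T)" using A(1) T(1) by auto
  then obtain \<sigma> where "\<not> (\<exists>x\<in>A - T. \<forall>i. x \<in> P i (\<sigma> i))"
    using irr[of "A - T"] U(2) T(2) by blast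
  then have "\<not> (\<forall>n. \<exists>x\<in>A - T. \<forall>i<n. x \<in> P i (\<sigma> i))"
    using closed_sets_meet[where Q = "\<lambda>i. P i (\<sigma> i)", OF cpt P cAT] by (metis (no_types, lifting))
  then obtain n where n: "\<And>x. x \<in> A - T \<Longrightarrow> \<not> (\<forall>i<n. x \<in> P i (\<sigma> i))"
    by blast
  have tail: "\<exists>x\<in>U. \<forall>i\<ge>n. x \<in> P i \<beta>" for \<beta>
  proof -
    obtain x where x: "x \<in> A" "\<And>i. x \<in> P i (if i < n then \<sigma> i else \<beta>)"
      using A(2)[of "\<lambda>i. if i < n then \<sigma> i else \<beta>"] by auto
    have "\<forall>i<n. x \<in> P i (\<sigma> i)"
    proof (intro allI impI)
      fix i assume "i < n"
      then show "x \<in> P i (\<sigma> i)" using x(2)[of i] by simp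
    qed
    then have "x \<in> U" using n x(1) T(2) by blast
    moreover have "\<forall>i\<ge>n. x \<in> P i \<beta>"
    proof (intro allI impI)
      fix i assume "n \<le> i"
      then show "x \<in> P i \<beta>" using x(2)[of i] by simp
    qed
    ultimately show ?thesis by blast
  qed
  have fp: "continuous_on UNIV (\<lambda>q :: 'x \<Rightarrow> 'x. f (q x))" for x
    by (rule continuous_on_compose2[OF f]) auto
  obtain x where x: "x \<in> U" "\<forall>i\<ge>n. f (g i x) \<le> a" using tail[of False] by (auto simp: P_def)
  obtain y where y: "y \<in> U" "\<forall>i\<ge>n. b \<le> f (g i y)" using tail[of True] by (auto simp: P_def)
  have "closure (g ` {n..}) \<subseteq> {q. f (q x) \<le> a}"
    by (rule closure_minimal) (use x(2) fp in \<open>auto intro!: closed_Collect_le\<close>)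
  moreover have "closure (g ` {n..}) \<subseteq> {q. b \<le> f (q y)}"
    by (rule closure_minimal) (use y(2) fp in \<open>auto intro!: closed_Collect_le\<close>)
  ultimately have "f (p x) \<le> a" "b \<le> f (p y)" using p[of n] by auto
  moreover have "\<bar>f (p x) - f (p y)\<bar> < b - a" using U(3) x(1) y(1) by (auto simp: V_def)
  ultimately show False by linarith
qed

section \<open>Regular measures are determined by their integrals\<close>

lemma regular_borel_prob_eqI:
  fixes \<mu> \<nu> :: "'x::t2_space measure"
  assumes cpt: "compact (UNIV :: 'x set)" and reg: "regular_borel_prob \<mu>" "regular_borel_prob \<nu>"
    and eq: "\<And>f :: 'x \<Rightarrow> real. continuous_on UNIV f \<Longrightarrow> (\<And>x. 0 \<le> f x \<and> f x \<le> 1) \<Longrightarrow>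
      integral\<^sup>L \<mu> f = integral\<^sup>L \<nu> f"
  shows "\<mu> = \<nu>"
proof -
  have "Hausdorff_space (euclidean :: 'x topology)"
    unfolding Hausdorff_space_def disjnt_def using hausdorff by auto
  then have normal: "normal_space (euclidean :: 'x topology)"
    using cpt by (intro compact_Hausdorff_or_regular_imp_normal_space) (auto simp: compact_space_def)
  have le: "emeasure \<mu> B \<le> emeasure \<nu> B"
    if reg: "regular_borel_prob \<mu>" "regular_borel_prob \<nu>"
      and eq: "\<And>f :: 'x \<Rightarrow> real. continuous_on UNIV f \<Longrightarrow> (\<And>x. 0 \<le> f x \<and> f x \<le> 1) \<Longrightarrow>
        integral\<^sup>L \<mu> f = integral\<^sup>L \<nu> f"
      and B: "B \<in> sets borel" for \<mu> \<nu> :: "'x measure" and B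
  proof -
    interpret \<mu>: prob_space \<mu> using reg(1) by (simp add: regular_borel_prob_def)
    interpret \<nu>: prob_space \<nu> using reg(2) by (simp add: regular_borel_prob_def)
    have sets: "sets \<mu> = sets borel" "sets \<nu> = sets borel" using reg by (auto simp: regular_borel_prob_def)
    have KU: "emeasure \<mu> K \<le> emeasure \<nu> U" if sub: "compact K" "open U" "K \<subseteq> U" for K U
    proof -
      have K: "closed K" using sub(1) by (rule compact_imp_closed)
      obtain f where f: "continuous_map euclidean (top_of_set {0..1::real}) f"
        "f ` (- U) \<subseteq> {0}" "f ` K \<subseteq> {1}"
      proof (rule Urysohn_lemma[OF normal, of "- U" K 0 1])
        show "closedin euclidean (- U)" "closedin euclidean K" "disjnt (- U) K"
          using sub K by (auto simp: disjnt_def)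
      qed auto
      have cf: "continuous_on UNIV f" and f01: "\<And>x. 0 \<le> f x \<and> f x \<le> 1"
        using f(1) by (auto simp: continuous_map_in_subtopology Pi_iff image_subset_iff)
      have mf: "f \<in> borel_measurable \<mu>" "f \<in> borel_measurable \<nu>"
        using borel_measurable_continuous_onI[OF cf] sets by (auto cong: measurable_cong_sets)
      have intf: "integrable \<mu> f" "integrable \<nu> f"
        using f01 mf by (auto intro!: \<mu>.integrable_const_bound[where B = 1] \<nu>.integrable_const_bound[where B = 1])
      have KUs: "K \<in> sets \<mu>" "U \<in> sets \<nu>" using K sub(2) sets by auto
      have "\<mu>.prob K = integral\<^sup>L \<mu> (indicat_real K)" using KUs(1) by (simp add: sets.sets_into_space Int_absorb2)
      also have "\<dots> \<le> integral\<^sup>L \<mu> f"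
        by (rule integral_mono) (use KUs intf f f01 in \<open>auto simp: indicator_def less_top[symmetric]\<close>)
      also have "\<dots> = integral\<^sup>L \<nu> f" by (rule eq[OF cf f01])
      also have "\<dots> \<le> integral\<^sup>L \<nu> (indicat_real U)"
        by (rule integral_mono) (use KUs intf f f01 in \<open>auto simp: indicator_def less_top[symmetric]\<close>)
      also have "\<dots> = \<nu>.prob U" using KUs(2) by (simp add: sets.sets_into_space Int_absorb2)
      finally show ?thesis by (simp add: \<mu>.emeasure_eq_measure \<nu>.emeasure_eq_measure)
    qed
    have K: "emeasure \<mu> K \<le> emeasure \<nu> K" if "compact K" for K
    proof -
      have "K \<in> sets borel" using borel_closed[OF compact_imp_closed[OF that]] .
      with reg(2)[unfolded regular_borel_prob_def, THEN conjunct2, THEN conjunct2, THEN conjunct2]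
      have "emeasure \<nu> K = (INF U \<in> {U. K \<subseteq> U \<and> open U}. emeasure \<nu> U)" by (rule bspec)
      then show ?thesis using KU[OF that] by (auto intro!: INF_greatest)
    qed
    have inner: "emeasure M B = (SUP K \<in> {K. K \<subseteq> B \<and> compact K}. emeasure M K)"
      if "regular_borel_prob M" for M
      using that[unfolded regular_borel_prob_def, THEN conjunct2, THEN conjunct2, THEN conjunct1] B
      by (rule bspec)
    have "emeasure \<mu> B = (SUP K \<in> {K. K \<subseteq> B \<and> compact K}. emeasure \<mu> K)"
      by (rule inner[OF reg(1)])
    also have "\<dots> \<le> (SUP K \<in> {K. K \<subseteq> B \<and> compact K}. emeasure \<nu> K)"
      by (rule SUP_subset_mono) (use K in auto)
    also have "\<dots> = emeasure \<nu> B"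
      by (rule inner[OF reg(2), symmetric])
    finally show ?thesis .
  qed
  show ?thesis
  proof (rule measure_eqI)
    show "sets \<mu> = sets \<nu>" using reg by (simp add: regular_borel_prob_def)
    fix B assume "B \<in> sets \<mu>"
    then have B: "B \<in> sets borel" using reg by (simp add: regular_borel_prob_def)
    show "emeasure \<mu> B = emeasure \<nu> B"
      using le[OF reg eq B] le[OF reg(2,1) eq[symmetric] B] by (rule antisym)
  qed
qed

section \<open>Almost invariant averages on a minimal flow\<close>

lemma integrable_bounded_continuous:
  fixes h :: "'x::topological_space \<Rightarrow> real"
  assumes "prob_space \<mu>" "sets \<mu> = sets borel" "continuous_on UNIV h" "\<And>x. \<bar>h x\<bar> \<le> B"
  shows "integrable \<mu> h"
proof -
  interpret prob_space \<mu> by fact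
  have "h \<in> borel_measurable \<mu>"
    using borel_measurable_continuous_onI[OF assms(3)] assms(2) by (simp cong: measurable_cong_sets)
  then show ?thesis using assms(4) by (intro integrable_const_bound[where B = B]) auto
qed

context flow
begin

lemma action_continuous: "g \<in> carrier G \<Longrightarrow> continuous_on UNIV (\<phi> g)"
  using homeo by (auto simp: homeomorphism_def)

definition translates :: "('x \<Rightarrow> real) \<Rightarrow> ('x \<Rightarrow> real) set" where
  "translates f = {\<lambda>x. f (\<phi> g x) |g. g \<in> carrier G}"

lemma hull_translate:
  assumes "\<psi> \<in> midpoint_hull (translates f)" "h \<in> carrier G"
  shows "(\<lambda>x. \<psi> (\<phi> h x)) \<in> midpoint_hull (translates f)"
  using assms(1)
proof induction
  case (base \<psi>)
  then obtain g where g: "g \<in> carrier G" "\<psi> = (\<lambda>x. f (\<phi> g x))" by (auto simp: translates_def)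
  interpret group G using group_hom by (simp add: group_hom_def)
  have "(\<lambda>x. \<psi> (\<phi> h x)) = (\<lambda>x. f (\<phi> (g \<otimes> h) x))"
    using g assms(2) by (simp add: composition_rule)
  moreover have "g \<otimes> h \<in> carrier G" using g assms(2) by simp
  ultimately show ?case by (auto simp: translates_def intro!: midpoint_hull.base)
qed (auto intro: midpoint_hull.midpoint)

lemma translates_continuous:
  assumes "continuous_on UNIV f" "h \<in> translates f"
  shows "continuous_on UNIV h"
  using assms continuous_on_compose2[OF assms(1) action_continuous] by (auto simp: translates_def)

lemma hull_continuous:
  assumes "\<psi> \<in> midpoint_hull (translates f)" "continuous_on UNIV f"
  shows "continuous_on UNIV \<psi>"
  using midpoint_hull_continuous[OF assms(1)] translates_continuous[OF assms(2)] by blast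

lemma hull_unit:
  assumes "\<psi> \<in> midpoint_hull (translates f)" "\<And>x. 0 \<le> f x \<and> f x \<le> 1"
  shows "0 \<le> \<psi> x \<and> \<psi> x \<le> 1"
  by (rule midpoint_hull_unit_interval[OF assms(1)]) (use assms(2) in \<open>auto simp: translates_def\<close>)

lemma integral_translate:
  assumes \<mu>: "sets \<mu> = sets borel" "invariant_measure G \<phi> \<mu>"
    and f: "continuous_on UNIV f" and g: "g \<in> carrier G"
  shows "integral\<^sup>L \<mu> (\<lambda>x. f (\<phi> g x)) = (integral\<^sup>L \<mu> f :: real)"
proof -
  have m: "\<phi> g \<in> measurable \<mu> borel"
    using borel_measurable_continuous_onI[OF action_continuous[OF g]] \<mu>(1)
    by (simp cong: measurable_cong_sets)
  have "integral\<^sup>L \<mu> (\<lambda>x. f (\<phi> g x)) = integral\<^sup>L (distr \<mu> borel (\<phi> g)) f"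
    using integral_distr[OF m borel_measurable_continuous_onI[OF f]] by simp
  then show ?thesis using \<mu>(2) g by (simp add: invariant_measure_def)
qed

lemma hull_integral:
  assumes \<mu>: "prob_space \<mu>" "sets \<mu> = sets borel" "invariant_measure G \<phi> \<mu>"
    and f: "continuous_on UNIV f" "\<And>x. 0 \<le> f x \<and> f x \<le> 1"
    and \<psi>: "\<psi> \<in> midpoint_hull (translates f)"
  shows "integral\<^sup>L \<mu> \<psi> = integral\<^sup>L \<mu> f"
proof -
  have "continuous_on UNIV \<psi> \<and> (\<forall>x. 0 \<le> \<psi> x \<and> \<psi> x \<le> 1)" if "\<psi> \<in> midpoint_hull (translates f)" for \<psi>
    using hull_continuous[OF that f(1)] hull_unit[OF that f(2)] by blast
  then have int: "integrable \<mu> \<psi>" if "\<psi> \<in> midpoint_hull (translates f)" for \<psi>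
    using that by (intro integrable_bounded_continuous[OF \<mu>(1,2), where B = 1]) (auto simp: abs_le_iff intro: order_trans)
  show ?thesis using \<psi>
  proof induction
    case (base h)
    then obtain g where "g \<in> carrier G" "h = (\<lambda>x. f (\<phi> g x))" by (auto simp: translates_def)
    then show ?case using integral_translate[OF \<mu>(2,3) f(1)] by simp
  next
    case (midpoint \<psi> \<xi>)
    then show ?case using int by simp
  qed
qed

text \<open>
  The mean ergodic argument: choose \<open>\<psi> n\<close> in the hull so that the sum of its squared norms in
  \<open>L\<^sup>2(\<mu>)\<close> and \<open>L\<^sup>2(\<nu>)\<close> approaches the infimum. A translate of \<open>\<psi> n\<close> has the same norm and so has nearly
  minimal norm as well, while the midpoint of the two cannot go below the infimum; the parallelogram
  law then makes their difference small. Minimising one quantity makes the same averages work for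
  both measures.
\<close>

lemma almost_invariant_averages:
  assumes \<mu>: "prob_space \<mu>" "sets \<mu> = sets borel" "invariant_measure G \<phi> \<mu>"
    and \<nu>: "prob_space \<nu>" "sets \<nu> = sets borel" "invariant_measure G \<phi> \<nu>"
    and f: "continuous_on UNIV f" "\<And>x. 0 \<le> f x \<and> f x \<le> 1"
  obtains \<psi> where "\<And>n. \<psi> n \<in> midpoint_hull (translates f)"
    "\<And>g. g \<in> carrier G \<Longrightarrow> (\<lambda>n. integral\<^sup>L \<mu> (\<lambda>x. (\<psi> n x - \<psi> n (\<phi> g x))\<^sup>2)) \<longlonglongrightarrow> 0"
    "\<And>g. g \<in> carrier G \<Longrightarrow> (\<lambda>n. integral\<^sup>L \<nu> (\<lambda>x. (\<psi> n x - \<psi> n (\<phi> g x))\<^sup>2)) \<longlonglongrightarrow> 0"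
proof -
  define H where "H = midpoint_hull (translates f)"
  have cont: "continuous_on UNIV \<psi>" and unit: "0 \<le> \<psi> x \<and> \<psi> x \<le> 1" if "\<psi> \<in> H" for \<psi> x
    using hull_continuous[OF that[unfolded H_def] f(1)] hull_unit[OF that[unfolded H_def] f(2)] by auto
  have sq: "\<bar>\<psi> x * \<psi> x\<bar> \<le> 1" if "\<psi> \<in> H" for \<psi> x
    using unit[OF that, of x] by (auto simp: abs_mult intro!: mult_le_one)
  have int: "integrable \<mu> (\<lambda>x. \<psi> x * \<psi> x)" "integrable \<nu> (\<lambda>x. \<psi> x * \<psi> x)" if "\<psi> \<in> H" for \<psi>
    using cont[OF that] sq[OF that]
    by (auto intro!: integrable_bounded_continuous[OF \<mu>(1,2), where B = 1]
      integrable_bounded_continuous[OF \<nu>(1,2), where B = 1] continuous_intros)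
  define N where "N \<psi> = integral\<^sup>L \<mu> (\<lambda>x. \<psi> x * \<psi> x) + integral\<^sup>L \<nu> (\<lambda>x. \<psi> x * \<psi> x)" for \<psi> :: "'x \<Rightarrow> real"
  define d where "d = Inf (N ` H)"
  have N0: "N \<psi> \<ge> 0" for \<psi> unfolding N_def by (intro add_nonneg_nonneg integral_nonneg) auto
  have bdd: "bdd_below (N ` H)" using N0 by (intro bdd_belowI[of _ 0]) auto
  have d_le: "d \<le> N \<psi>" if "\<psi> \<in> H" for \<psi> unfolding d_def using that by (intro cInf_lower bdd) auto
  interpret group G using group_hom by (simp add: group_hom_def)
  have "(\<lambda>x. f (\<phi> \<one> x)) \<in> H" unfolding H_def by (rule midpoint_hull.base) (auto simp: translates_def)
  then have ne: "N ` H \<noteq> {}" by blast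
  have "\<exists>\<psi>\<in>H. N \<psi> < d + inverse (Suc n)" for n
    using cInf_less_iff[OF ne bdd, of "d + inverse (Suc n)"] by (auto simp: d_def)
  then obtain \<psi> where \<psi>: "\<And>n. \<psi> n \<in> H" "\<And>n. N (\<psi> n) < d + inverse (Suc n)" by metis
  have small: "integral\<^sup>L \<mu> (\<lambda>x. (\<psi> n x - \<psi> n (\<phi> g x))\<^sup>2) + integral\<^sup>L \<nu> (\<lambda>x. (\<psi> n x - \<psi> n (\<phi> g x))\<^sup>2)
      \<le> 4 * inverse (Suc n)" if g: "g \<in> carrier G" for g n
  proof -
    define \<xi> where "\<xi> x = \<psi> n (\<phi> g x)" for x
    define \<eta> where "\<eta> x = (\<psi> n x + \<xi> x) / 2" for x
    have \<xi>: "\<xi> \<in> H" using hull_translate[of "\<psi> n" f g] \<psi>(1)[of n] g unfolding H_def \<xi>_def[abs_def] by blast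
    have \<eta>: "\<eta> \<in> H" using midpoint_hull.midpoint[of "\<psi> n" "translates f" \<xi>] \<psi>(1)[of n] \<xi> unfolding H_def \<eta>_def[abs_def] by blast
    have c2: "continuous_on UNIV (\<lambda>x. \<psi> n x * \<psi> n x)" by (intro continuous_intros cont[OF \<psi>(1)])
    have N\<xi>: "N \<xi> = N (\<psi> n)"
      unfolding N_def \<xi>_def
      using integral_translate[OF \<mu>(2,3) c2 g] integral_translate[OF \<nu>(2,3) c2 g] by simp
    have eq: "(\<lambda>x. (\<psi> n x - \<psi> n (\<phi> g x))\<^sup>2) = (\<lambda>x. 2 * (\<psi> n x * \<psi> n x) + 2 * (\<xi> x * \<xi> x) - 4 * (\<eta> x * \<eta> x))"
      by (auto simp: \<eta>_def \<xi>_def power2_eq_square field_simps)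
    have "integral\<^sup>L \<mu> (\<lambda>x. (\<psi> n x - \<psi> n (\<phi> g x))\<^sup>2) + integral\<^sup>L \<nu> (\<lambda>x. (\<psi> n x - \<psi> n (\<phi> g x))\<^sup>2)
        = 2 * N (\<psi> n) + 2 * N \<xi> - 4 * N \<eta>"
      unfolding eq N_def using int[OF \<psi>(1)[of n]] int[OF \<xi>] int[OF \<eta>] by simp
    then show ?thesis using N\<xi> d_le[OF \<eta>] \<psi>(2)[of n] by simp
  qed
  have lim: "(\<lambda>n. 4 * inverse (real (Suc n))) \<longlonglongrightarrow> 0"
    using tendsto_mult_right_zero[OF LIMSEQ_inverse_real_of_nat] .
  show ?thesis
  proof
    show "\<psi> n \<in> midpoint_hull (translates f)" for n using \<psi>(1) by (simp add: H_def)
  next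
    fix g assume g: "g \<in> carrier G"
    have nn: "0 \<le> integral\<^sup>L M (\<lambda>x. (\<psi> n x - \<psi> n (\<phi> g x))\<^sup>2)" for M n by simp
    show "(\<lambda>n. integral\<^sup>L \<mu> (\<lambda>x. (\<psi> n x - \<psi> n (\<phi> g x))\<^sup>2)) \<longlonglongrightarrow> 0"
    proof (rule tendsto_sandwich[OF always_eventually always_eventually tendsto_const lim]; intro allI)
      fix n show "integral\<^sup>L \<mu> (\<lambda>x. (\<psi> n x - \<psi> n (\<phi> g x))\<^sup>2) \<le> 4 * inverse (real (Suc n))"
        using small[OF g, of n] nn[of \<nu> n] by linarith
    qed (rule nn)
    show "(\<lambda>n. integral\<^sup>L \<nu> (\<lambda>x. (\<psi> n x - \<psi> n (\<phi> g x))\<^sup>2)) \<longlonglongrightarrow> 0"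
    proof (rule tendsto_sandwich[OF always_eventually always_eventually tendsto_const lim]; intro allI)
      fix n show "integral\<^sup>L \<nu> (\<lambda>x. (\<psi> n x - \<psi> n (\<phi> g x))\<^sup>2) \<le> 4 * inverse (real (Suc n))"
        using small[OF g, of n] nn[of \<mu> n] by linarith
    qed (rule nn)
  qed
qed

text \<open>
  Since the mean of \<open>\<psi> n\<close> is \<open>\<alpha>\<close>, it is well below \<open>a\<close> on a set whose measure has a positive lower bound independent of \<open>n\<close>. If it were at least \<open>a\<close> on all of \<open>U\<close>, then,
  as finitely many group elements carry each point of the space into \<open>U\<close>, one of them would have to
  raise the value of \<open>\<psi> n\<close> by a fixed amount on a set of measure bounded away from 0.
\<close>

lemma almost_invariant_small_everywhere:
  fixes \<psi> :: "nat \<Rightarrow> 'x \<Rightarrow> real"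
  assumes min: "minimal_flow G \<phi>" and \<mu>: "prob_space \<mu>" "sets \<mu> = sets borel"
    and cont: "\<And>n. continuous_on UNIV (\<psi> n)" and unit: "\<And>n x. 0 \<le> \<psi> n x \<and> \<psi> n x \<le> 1"
    and int: "\<And>n. integral\<^sup>L \<mu> (\<psi> n) = \<alpha>" and a: "\<alpha> < a" "a \<le> 1"
    and inv: "\<And>g. g \<in> carrier G \<Longrightarrow> (\<lambda>n. integral\<^sup>L \<mu> (\<lambda>x. (\<psi> n x - \<psi> n (\<phi> g x))\<^sup>2)) \<longlonglongrightarrow> 0"
    and U: "open U" "U \<noteq> {}"
  shows "\<forall>\<^sub>F n in sequentially. \<exists>x\<in>U. \<psi> n x < a"
proof -
  interpret \<mu>: prob_space \<mu> by fact
  have "\<exists>g\<in>carrier G. \<phi> g x \<in> U" for x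
  proof -
    have "orbit G \<phi> x \<inter> U \<noteq> {}"
      using min U open_Int_closure_eq_empty[OF U(1), of "orbit G \<phi> x"]
      by (auto simp: minimal_flow_def Int_commute)
    then show ?thesis by (auto simp: orbit_def)
  qed
  then have "UNIV \<subseteq> (\<Union>g\<in>carrier G. \<phi> g -` U)" by auto
  moreover have "open (\<phi> g -` U)" if "g \<in> carrier G" for g
    using open_vimage[OF U(1) action_continuous[OF that]] .
  ultimately obtain J where J: "J \<subseteq> carrier G" "finite J" "UNIV \<subseteq> (\<Union>g\<in>J. \<phi> g -` U)"
    using compactE_image[OF compact_space, of "carrier G" "\<lambda>g. \<phi> g -` U"] by metis
  define I where "I g n = integral\<^sup>L \<mu> (\<lambda>x. (\<psi> n x - \<psi> n (\<phi> g x))\<^sup>2)" for g n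
  define \<delta> where "\<delta> = (a - \<alpha>) / 2"
  have \<delta>: "\<delta> > 0" using a by (simp add: \<delta>_def)
  have "(\<lambda>n. \<Sum>g\<in>J. I g n) \<longlonglongrightarrow> (\<Sum>g\<in>J. 0)"
    unfolding I_def using inv J(1) by (intro tendsto_sum) auto
  then have "\<forall>\<^sub>F n in sequentially. (\<Sum>g\<in>J. I g n) < \<delta>\<^sup>2 * \<delta>"
    by (rule order_tendstoD) (use \<delta> in simp)
  then show ?thesis
  proof eventually_elim
    case (elim n)
    show ?case
    proof (rule ccontr)
      assume "\<not> ?case"
      then have big: "a \<le> \<psi> n x" if "x \<in> U" for x using that by force
      (* The margin a - \<delta> is halfway between \<alpha> and a, so the left-hand side has positive mean. *)
      have pt: "\<delta>\<^sup>2 * ((a - \<delta>) - \<psi> n x) \<le> (\<Sum>g\<in>J. (\<psi> n x - \<psi> n (\<phi> g x))\<^sup>2)" for x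
      proof (cases "\<psi> n x \<ge> a - \<delta>")
        case True
        then have "\<delta>\<^sup>2 * ((a - \<delta>) - \<psi> n x) \<le> 0" by (simp add: mult_nonneg_nonpos)
        also have "\<dots> \<le> (\<Sum>g\<in>J. (\<psi> n x - \<psi> n (\<phi> g x))\<^sup>2)" by (intro sum_nonneg) auto
        finally show ?thesis .
      next
        case False
        obtain g where g: "g \<in> J" "\<phi> g x \<in> U" using J(3) by blast
        have "\<delta>\<^sup>2 * ((a - \<delta>) - \<psi> n x) \<le> \<delta>\<^sup>2 * 1"
          using a(2) \<delta> unit[of n x] by (intro mult_left_mono) auto
        also have "\<dots> \<le> (\<psi> n (\<phi> g x) - \<psi> n x)\<^sup>2"
          using big[OF g(2)] False \<delta> by (simp add: power_mono)
        also have "\<dots> = (\<psi> n x - \<psi> n (\<phi> g x))\<^sup>2" by (rule power2_commute)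
        also have "\<dots> \<le> (\<Sum>g\<in>J. (\<psi> n x - \<psi> n (\<phi> g x))\<^sup>2)"
          using g(1) J(2) by (intro member_le_sum) auto
        finally show ?thesis .
      qed
      have int1: "integrable \<mu> (\<psi> n)"
        by (rule integrable_bounded_continuous[OF \<mu> cont, where B = 1]) (use unit in \<open>auto simp: abs_le_iff intro: order_trans[OF _ zero_le_one]\<close>)
      have int2: "integrable \<mu> (\<lambda>x. (\<psi> n x - \<psi> n (\<phi> g x))\<^sup>2)" if "g \<in> J" for g
      proof (rule integrable_bounded_continuous[OF \<mu>, where B = 1])
        have "continuous_on UNIV (\<lambda>x. \<psi> n (\<phi> g x))"
          using continuous_on_compose2[OF cont action_continuous[of g]] that J(1) by auto
        then show "continuous_on UNIV (\<lambda>x. (\<psi> n x - \<psi> n (\<phi> g x))\<^sup>2)"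
          by (intro continuous_intros cont)
        show "\<bar>(\<psi> n x - \<psi> n (\<phi> g x))\<^sup>2\<bar> \<le> 1" for x
          using unit[of n x] unit[of n "\<phi> g x"] by (simp add: abs_square_le_1 abs_le_iff)
      qed
      have "\<delta>\<^sup>2 * \<delta> = \<delta>\<^sup>2 * ((a - \<delta>) - \<alpha>)" by (simp add: \<delta>_def field_simps)
      also have "\<dots> = integral\<^sup>L \<mu> (\<lambda>x. \<delta>\<^sup>2 * ((a - \<delta>) - \<psi> n x))"
        using int1 int \<mu>.prob_space by simp
      also have "\<dots> \<le> integral\<^sup>L \<mu> (\<lambda>x. \<Sum>g\<in>J. (\<psi> n x - \<psi> n (\<phi> g x))\<^sup>2)"
        by (rule integral_mono) (use int1 int2 pt in auto)
      also have "\<dots> = (\<Sum>g\<in>J. I g n)" using int2 by (simp add: I_def)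
      finally show False using elim by simp
    qed
  qed
qed

text \<open>
  If the integral of \<open>f\<close> were larger for \<open>\<nu>\<close> than for \<open>\<mu>\<close>, the almost invariant averages would have one
  mean for \<open>\<mu>\<close> and a larger one for \<open>\<nu>\<close>, hence would fall below \<open>a\<close> and exceed \<open>b\<close> on every nonempty
  open set eventually. A subsequence would be independent, and so would a sequence of translates of
  \<open>f\<close>.
\<close>

lemma invariant_integrals_le:
  fixes f :: "'x \<Rightarrow> real"
  assumes min: "minimal_flow G \<phi>"
    and tame: "\<And>s a b. (\<And>i::nat. s i \<in> carrier G) \<Longrightarrow> a < b \<Longrightarrow> \<not> independent_seq (\<lambda>i x. f (\<phi> (s i) x)) a b"
    and \<mu>: "prob_space \<mu>" "sets \<mu> = sets borel" "invariant_measure G \<phi> \<mu>"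
    and \<nu>: "prob_space \<nu>" "sets \<nu> = sets borel" "invariant_measure G \<phi> \<nu>"
    and f: "continuous_on UNIV f" "\<And>x. 0 \<le> f x \<and> f x \<le> 1"
  shows "integral\<^sup>L \<nu> f \<le> integral\<^sup>L \<mu> f"
proof (rule ccontr)
  assume *: "\<not> integral\<^sup>L \<nu> f \<le> integral\<^sup>L \<mu> f"
  define \<alpha> where "\<alpha> = integral\<^sup>L \<mu> f"
  define \<beta> where "\<beta> = integral\<^sup>L \<nu> f"
  have \<alpha>\<beta>: "\<alpha> < \<beta>" using * by (simp add: \<alpha>_def \<beta>_def)
  interpret \<mu>: prob_space \<mu> by fact
  interpret \<nu>: prob_space \<nu> by fact
  have intf: "integrable \<mu> f" "integrable \<nu> f"
    using f(2) by (auto intro!: integrable_bounded_continuous[OF \<mu>(1,2) f(1), where B = 1]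
      integrable_bounded_continuous[OF \<nu>(1,2) f(1), where B = 1])
  have "0 \<le> \<alpha>" unfolding \<alpha>_def using f(2) by (intro Bochner_Integration.integral_nonneg) auto
  moreover have "\<beta> \<le> 1"
    unfolding \<beta>_def using integral_mono[of \<nu> f "\<lambda>x. 1"] intf f(2) \<nu>.prob_space by simp
  moreover define a b where "a = \<alpha> + (\<beta> - \<alpha>) / 3" "b = \<beta> - (\<beta> - \<alpha>) / 3"
  ultimately have ab: "\<alpha> < a" "a < b" "b < \<beta>" "a \<le> 1" "0 \<le> b" using \<alpha>\<beta> by (auto simp: field_simps)
  obtain \<psi> where \<psi>: "\<And>n. \<psi> n \<in> midpoint_hull (translates f)"
    and inv_\<mu>: "\<And>g. g \<in> carrier G \<Longrightarrow> (\<lambda>n. integral\<^sup>L \<mu> (\<lambda>x. (\<psi> n x - \<psi> n (\<phi> g x))\<^sup>2)) \<longlonglongrightarrow> 0"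
    and inv_\<nu>: "\<And>g. g \<in> carrier G \<Longrightarrow> (\<lambda>n. integral\<^sup>L \<nu> (\<lambda>x. (\<psi> n x - \<psi> n (\<phi> g x))\<^sup>2)) \<longlonglongrightarrow> 0"
    using almost_invariant_averages[OF \<mu> \<nu> f] by blast
  have cont: "continuous_on UNIV (\<psi> n)" for n by (rule hull_continuous[OF \<psi> f(1)])
  have unit: "0 \<le> \<psi> n x \<and> \<psi> n x \<le> 1" for n x by (rule hull_unit[OF \<psi> f(2)])
  have int_\<mu>: "integral\<^sup>L \<mu> (\<psi> n) = \<alpha>" and int_\<nu>: "integral\<^sup>L \<nu> (\<psi> n) = \<beta>" for n
    unfolding \<alpha>_def \<beta>_def by (rule hull_integral[OF \<mu> f \<psi>], rule hull_integral[OF \<nu> f \<psi>])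
  have "integrable \<nu> (\<psi> n)" for n
    using unit by (auto intro!: integrable_bounded_continuous[OF \<nu>(1,2) cont, where B = 1])
  then have int_compl: "integral\<^sup>L \<nu> (\<lambda>x. 1 - \<psi> n x) = 1 - \<beta>" for n
    using int_\<nu> \<nu>.prob_space by simp
  have inv_compl: "(\<lambda>n. integral\<^sup>L \<nu> (\<lambda>x. ((1 - \<psi> n x) - (1 - \<psi> n (\<phi> g x)))\<^sup>2)) \<longlonglongrightarrow> 0"
    if "g \<in> carrier G" for g
    using inv_\<nu>[OF that] by (simp add: power2_commute)
  have low: "\<forall>\<^sub>F n in sequentially. \<exists>x\<in>U. \<psi> n x < a" if "open U" "U \<noteq> {}" for U
    by (rule almost_invariant_small_everywhere[OF min \<mu>(1,2) cont unit int_\<mu> ab(1,4) inv_\<mu> that])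
  have high: "\<forall>\<^sub>F n in sequentially. \<exists>x\<in>U. b < \<psi> n x" if "open U" "U \<noteq> {}" for U
  proof -
    have "\<forall>\<^sub>F n in sequentially. \<exists>x\<in>U. 1 - \<psi> n x < 1 - b"
      by (rule almost_invariant_small_everywhere[OF min \<nu>(1,2) _ _ int_compl _ _ inv_compl that])
         (use cont unit ab in \<open>auto intro!: continuous_intros\<close>)
    then show ?thesis by simp
  qed
  have "\<exists>r :: nat \<Rightarrow> nat. \<forall>\<sigma> n. open (UNIV \<inter> {x. \<forall>i<n. if \<sigma> i then x \<in> {x. b < \<psi> (r i) x} else x \<in> {x. \<psi> (r i) x < a}}) \<and>
      UNIV \<inter> {x. \<forall>i<n. if \<sigma> i then x \<in> {x. b < \<psi> (r i) x} else x \<in> {x. \<psi> (r i) x < a}} \<noteq> {}"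
  proof (rule independent_subsequence[where big = "\<lambda>U. open U \<and> U \<noteq> {}" and F = sequentially
        and A = "\<lambda>n. {x. \<psi> n x < a}" and B = "\<lambda>n. {x. b < \<psi> n x}"])
    fix U :: "'x set" assume U: "open U \<and> U \<noteq> {}"
    have op: "open {x. \<psi> n x < a}" "open {x. b < \<psi> n x}" for n
      by (auto intro!: open_Collect_less cont continuous_intros)
    have "\<forall>\<^sub>F n in sequentially. (\<exists>x\<in>U. \<psi> n x < a) \<and> (\<exists>x\<in>U. b < \<psi> n x)"
      using low high U by (intro eventually_conj) auto
    then show "\<forall>\<^sub>F n in sequentially. (open (U \<inter> {x. \<psi> n x < a}) \<and> U \<inter> {x. \<psi> n x < a} \<noteq> {}) \<and>
        (open (U \<inter> {x. b < \<psi> n x}) \<and> U \<inter> {x. b < \<psi> n x} \<noteq> {})"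
      by eventually_elim (use U op in \<open>auto intro!: open_Int\<close>)
  qed auto
  then obtain r :: "nat \<Rightarrow> nat" where r: "\<And>\<sigma> n. {x. \<forall>i<n. if \<sigma> i then b < \<psi> (r i) x else \<psi> (r i) x < a} \<noteq> {}"
    unfolding mem_Collect_eq Int_UNIV_left by blast
  then have ind: "independent_seq (\<lambda>i. \<psi> (r i)) a b"
    unfolding independent_seq_def by blast
  have t_cont: "continuous_on UNIV h" if "h \<in> translates f" for h
    by (rule translates_continuous[OF f(1) that])
  have t_unit: "0 \<le> h x \<and> h x \<le> 1" if "h \<in> translates f" for h x
    using that f(2) by (auto simp: translates_def)
  obtain h c d where h: "\<And>i. h i \<in> translates f" "c < d" "independent_seq h c d"
  proof (rule independent_seq_midpoint_hull[where S = "translates f" and \<psi> = "\<lambda>i. \<psi> (r i)"])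
    show "independent_seq (\<lambda>i. \<psi> (r i)) a b" by (rule ind)
    show "\<psi> (r i) \<in> midpoint_hull (translates f)" for i by (rule \<psi>)
    fix h c d
    assume "\<And>i. h i \<in> translates f" "c < d" "independent_seq h c d"
    then show thesis by (rule that)
  qed (use compact_space t_cont t_unit ab(2) in auto)
  have "\<exists>g. g \<in> carrier G \<and> h i = (\<lambda>x. f (\<phi> g x))" for i
    using h(1)[of i] by (auto simp: translates_def)
  then obtain s where s: "\<And>i. s i \<in> carrier G" "\<And>i. h i = (\<lambda>x. f (\<phi> (s i) x))" by metis
  have "h = (\<lambda>i x. f (\<phi> (s i) x))" using s(2) by auto
  then show False using tame[OF s(1) h(2)] h(3) by simp
qed

end

section \<open>Unique ergodicity\<close>

theorem theorem4p2:
  fixes G :: "('g, 'm) monoid_scheme"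
    and \<phi> :: "'g \<Rightarrow> 'x::{t2_space, uniform_space} \<Rightarrow> 'x"
  assumes "flow G \<phi>"
    and "minimal_flow G \<phi>"
    and "tame_flow G \<phi>"
    and "amenable_flow G \<phi>"
  shows "uniquely_ergodic G \<phi>"
proof -
  interpret flow G \<phi> by fact
  have no_independence: "\<not> independent_seq (\<lambda>i x. f (\<phi> (s i) x)) a b"
    if s: "\<And>i. s i \<in> carrier G" and f: "continuous_on UNIV f" and "a < b"
    for f :: "'x \<Rightarrow> real" and s :: "nat \<Rightarrow> 'g" and a b
  proof
    assume ind: "independent_seq (\<lambda>i x. f (\<phi> (s i) x)) a b"
    obtain p where p: "\<And>n. p \<in> closure ((\<lambda>i. \<phi> (s i)) ` {n..})"
      using cluster_point_exists[OF compact_UNIV_fun[OF compact_space], of "\<lambda>i. \<phi> (s i)"] by blast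
    have "closure ((\<lambda>i. \<phi> (s i)) ` {0..}) \<subseteq> closure (\<phi> ` carrier G)"
      using s by (intro closure_mono) auto
    then have "p \<in> enveloping_semigroup G \<phi>" using p[of 0] by (auto simp: enveloping_semigroup_def)
    then have "fragmented p" using assms(3) by (simp add: tame_flow_def)
    then show False
      using independent_cluster_point_not_fragmented[OF compact_space f, of "\<lambda>i. \<phi> (s i)" a b p]
        action_continuous[OF s] ind \<open>a < b\<close> p by blast
  qed
  have "\<mu> = \<nu>" if \<mu>: "regular_borel_prob \<mu>" "invariant_measure G \<phi> \<mu>"
    and \<nu>: "regular_borel_prob \<nu>" "invariant_measure G \<phi> \<nu>" for \<mu> \<nu>
  proof (rule regular_borel_prob_eqI[OF compact_space \<mu>(1) \<nu>(1)])
    fix f :: "'x \<Rightarrow> real" assume f: "continuous_on UNIV f" "\<And>x. 0 \<le> f x \<and> f x \<le> 1"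
    have P: "prob_space \<mu>" "sets \<mu> = sets borel" "prob_space \<nu>" "sets \<nu> = sets borel"
      using \<mu>(1) \<nu>(1) by (auto simp: regular_borel_prob_def)
    show "integral\<^sup>L \<mu> f = integral\<^sup>L \<nu> f"
      by (intro antisym invariant_integrals_le assms(2) no_independence P \<mu>(2) \<nu>(2) f)
  qed
  then show ?thesis
    using assms(4) unfolding uniquely_ergodic_def amenable_flow_def by blast
qed

end
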